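(* Let $m\geq 1$ and $p>m$ be integers and let $c_m$ be a real number with $m<c_m<m+1$. Then $$\begin{aligned}(2^{2m+1}-1)\,\zeta(2m+1)=&\ \frac{i(-1)^p}{\pi^{2p+1}}\int_{c_m-i\infty}^{c_m+i\infty}\frac{\Gamma(2p-2t)\,\pi^{2t}}{\sin(\pi t)}\sum_{k=0}^{\infty}(-1)^k\bigl(k+\tfrac12\bigr)^{2t-2p-2m-1}\,dt\\&-(-1)^m\pi^{2m}\left(\sum_{j=0}^{p-2-m}\frac{\Gamma(2j+2)\,\mathcal{E}(2j+2+2m)}{\Gamma(2j+3+2m)}+\sum_{j=0}^{m}\frac{\mathcal{E}(2j)\,\psi(1-2j+2m)}{\Gamma(1-2j+2m)\,\Gamma(2j+1)}\right).\end{aligned}$$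
   Context: $\zeta$ is the Riemann zeta function and $\psi=\Gamma'/\Gamma$ the digamma function. $\mathcal{E}(n)$ denotes the $n$-th Euler number, $1/\cosh x=\sum_{n\ge0}\mathcal{E}(n)x^n/n!$ (so $\mathcal{E}(0)=1$, $\mathcal{E}(2)=-1$, $\mathcal{E}(4)=5$). The integral is along the vertical line $\Re(t)=c_m$, oriented upwards. A sum whose lower limit exceeds its upper limit is zero. *)

theory Defs
  imports "HOL-Analysis.Analysis"
begin

text \<open>
  The Dirichlet series, i.e. the Riemann zeta function on its half-plane of absolute convergence
  \<open>Re s > 1\<close>. For other \<open>s\<close> this is not the analytic continuation; it is only to be used for
  \<open>Re s > 1\<close>.
\<close>

definition riemann_zeta :: "complex \<Rightarrow> complex" where
  "riemann_zeta s = (\<Sum>n. 1 / of_nat (Suc n) powr s)"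

lemma summable_riemann_zeta:
  assumes "Re s > 1"
  shows   "summable (\<lambda>n. 1 / of_nat (Suc n) powr s :: complex)"
proof -
  have "summable (\<lambda>n. exp (of_real (ln (of_nat n)) * (-s)))"
    using assms by (intro summable_complex_powr_iff) auto
  hence "summable (\<lambda>n. exp (of_real (ln (of_nat (Suc n))) * (-s)))"
    by (subst summable_Suc_iff)
  also have "(\<lambda>n. exp (of_real (ln (of_nat (Suc n))) * (-s))) =
             (\<lambda>n. 1 / of_nat (Suc n) powr s :: complex)"
  proof
    fix n :: nat
    have "Ln (of_nat (Suc n)) = of_real (ln (of_nat (Suc n)))"
      by (metis Ln_of_nat of_nat_0_less_iff zero_less_Suc of_real_of_nat_eq Ln_of_real)
    thus "exp (of_real (ln (of_nat (Suc n))) * (-s)) = 1 / of_nat (Suc n) powr s"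
      by (simp add: powr_def exp_minus field_simps del: of_nat_Suc)
  qed
  finally show ?thesis .
qed

definition fps_cosh :: "real fps" where
  "fps_cosh = fps_const (1/2) * (fps_exp 1 + fps_exp (-1))"

definition euler_number :: "nat \<Rightarrow> real" where
  "euler_number n = fact n * fps_nth (inverse fps_cosh) n"

lemma fps_cosh_nth: "fps_nth fps_cosh n = (if even n then 1 / fact n else 0)"
  by (auto simp: fps_cosh_def)

lemma euler_number_gf: "Abs_fps (\<lambda>n. euler_number n / fact n) * fps_cosh = 1"
proof -
  have "Abs_fps (\<lambda>n. euler_number n / fact n) = inverse fps_cosh"
    by (rule fps_ext) (simp add: euler_number_def)
  thus ?thesis by (simp add: inverse_mult_eq_1 fps_cosh_nth)
qed

lemma euler_number_0: "euler_number 0 = 1"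
  by (simp add: euler_number_def fps_cosh_nth)

lemma euler_number_2: "euler_number 2 = -1"
  using arg_cong[OF euler_number_gf, of "\<lambda>f. fps_nth f 2"]
  by (simp add: fps_mult_nth fps_cosh_nth euler_number_0 numeral_2_eq_2)

lemma euler_number_4: "euler_number 4 = 5"
proof -
  have set: "{0..4::nat} = {0, 1, 2, 3, 4}" by auto
  have "(\<Sum>i=0..4. euler_number i / fact i * fps_nth fps_cosh (4 - i)) = 0"
    using arg_cong[OF euler_number_gf, of "\<lambda>f. fps_nth f 4"] by (simp add: fps_mult_nth)
  thus ?thesis
    unfolding set by (simp add: fps_cosh_nth euler_number_0 euler_number_2 fact_numeral)
qed

text \<open>
  The line \<open>Re t = c\<close>, oriented upwards, is parametrised by \<open>t = c + \<i> y\<close>, so \<open>dt = \<i> dy\<close>.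
\<close>

definition vertical_line_integrable :: "real \<Rightarrow> (complex \<Rightarrow> complex) \<Rightarrow> bool" where
  "vertical_line_integrable c f \<longleftrightarrow> integrable lborel (\<lambda>y. f (Complex c y))"

definition vertical_line_integral :: "real \<Rightarrow> (complex \<Rightarrow> complex) \<Rightarrow> complex" where
  "vertical_line_integral c f = \<i> * (LINT y|lborel. f (Complex c y))"

end

theory Submission
  imports Defs "HOL-Probability.Sinc_Integral" "HOL-Complex_Analysis.Residue_Theorem"
begin

text \<open>
  Write \<open>a\<^sub>k = \<pi> (k + 1/2)\<close> and \<open>e\<^sub>j = \<E>(2 j) / (2 j)!\<close>, so that the \<open>e\<^sub>j\<close> are the Taylor coefficients
  of \<open>1 / cosh\<close>. Both sides of the identity are turned into series over the frequencies \<open>a\<^sub>k\<close>.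

  The contour integral is taken apart term by term. Inserting Euler's integral for
  \<open>\<Gamma>(2 p - 2 t)\<close> and exchanging the integrals leaves the integral of \<open>e\<^bsup>w t\<^esup> / sin (\<pi> t)\<close> along the line.
  Moving the line by one multiplies this integral by \<open>- e\<^bsup>w\<^esup>\<close> and crosses a single pole, so it
  equals an elementary multiple of \<open>1 / (1 + e\<^bsup>w\<^esup>)\<close> (\<open>vertical_integral_exp_over_sin\<close>). Hence, with
  \<open>S\<^sub>n(a) = \<integral>\<^sub>0\<^sup>\<infinity> x\<^sup>n e\<^bsup>-x\<^esup> / (x\<^sup>2 + a\<^sup>2) dx\<close>, the term containing the contour integral is
  \<open>(-1)\<^sup>m \<pi>\<^bsup>2 m\<^esup>\<close> times the series of \<open>-2 (-1)\<^bsup>p+k\<^esup> a\<^sub>k\<^bsup>1-2p\<^esup> S\<^bsub>2(p-m)-1\<^esub>(a\<^sub>k)\<close> (\<open>line_integral\<close>).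

  From \<open>S\<^bsub>n+2\<^esub>(a) = n! - a\<^sup>2 S\<^sub>n(a)\<close> and \<open>2 \<Sum>\<^sub>k (-1)\<^sup>k / a\<^sub>k\<^bsup>2j+1\<^esup> = (-1)\<^sup>j e\<^sub>j\<close>, raising \<open>p\<close> by one adds
  \<open>(2(p-m)-1)! e\<^sub>p\<close> to that series. This accounts for the first finite sum and leaves the case
  \<open>p = m + 1\<close>, in which only \<open>S\<^sub>1\<close> occurs. Now \<open>S\<^sub>1\<close> is an auxiliary function of the sine integral: because
  \<open>cos a\<^sub>k = 0\<close> and \<open>sin a\<^sub>k = (-1)\<^sup>k\<close>, one has \<open>(-1)\<^sup>k S\<^sub>1(a\<^sub>k) = \<pi>/2 - Si(a\<^sub>k)\<close> (\<open>stieltjes_freq\<close>). The constant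
  \<open>\<pi>/2\<close> yields \<open>\<Sum>\<^sub>k a\<^sub>k\<^bsup>-2m-1\<^esup>\<close>, which is the zeta value. What remains is the series of
  \<open>Si(a\<^sub>k) / a\<^sub>k\<^bsup>2m+1\<^esup>\<close>, which must produce the digamma values (\<open>sums_Si_freq\<close>).

  For this, \<open>Si(a) = \<integral>\<^sub>0\<^sup>1 sin (a u) / u du\<close> is used under the sum. The Fourier series
  \<open>2 \<Sum>\<^sub>k (-1)\<^sup>k cos (a\<^sub>k v) / a\<^sub>k\<^bsup>2m+1\<^esup>\<close> is, for \<open>0 \<le> v \<le> 1\<close>, the polynomial
  \<open>(-1)\<^sup>m \<Sum>\<^sub>j e\<^sub>j v\<^bsup>2m-2j\<^esup> / (2m-2j)!\<close> (\<open>sums_wave_poly\<close>): for \<open>m = 0\<close> it is the square wave, and each further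
  step integrates twice. Since \<open>sin (a\<^sub>k (1 - v)) = (-1)\<^sup>k cos (a\<^sub>k v)\<close>, integrating this polynomial against
  \<open>1 / (1 - v)\<close> gives harmonic numbers, as \<open>\<integral>\<^sub>0\<^sup>1 (1 - v\<^sup>n) / (1 - v) dv = H\<^sub>n\<close>. Finally
  \<open>\<psi>(n + 1) = H\<^sub>n - \<gamma>\<close>, and the contributions of \<open>\<gamma>\<close> cancel because \<open>cosh \<cdot> (1 / cosh) = 1\<close>.
\<close>

section \<open>The frequencies\<close>

definition freq :: "nat \<Rightarrow> real" where
  "freq k = pi * (real k + 1 / 2)"

lemma freq_pos [simp]: "freq k > 0"
  by (simp add: freq_def add_nonneg_pos)

lemma freq_nonzero [simp]: "freq k \<noteq> 0"
  using freq_pos[of k] by linarith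

lemma abs_freq [simp]: "\<bar>freq k\<bar> = freq k"
  using freq_pos[of k] by linarith

lemma sin_freq [simp]: "sin (freq k) = (-1) ^ k"
  using sin_cos_npi[of k] by (simp add: freq_def algebra_simps add_divide_distrib)

lemma cos_freq [simp]: "cos (freq k) = 0"
  by (simp add: freq_def algebra_simps cos_add)

lemma freq_ge: "freq k \<ge> real (Suc k)"
proof -
  have "real (Suc k) \<le> 2 * (real k + 1/2)" by simp
  also have "\<dots> \<le> pi * (real k + 1/2)"
    using pi_ge_two by (intro mult_right_mono) auto
  finally show ?thesis by (simp add: freq_def)
qed

lemma summable_inverse_freq_power:
  assumes "n \<ge> 2"
  shows "summable (\<lambda>k. 1 / freq k ^ n)"
proof (rule summable_comparison_test')
  have "summable (\<lambda>k. 1 / real k ^ n)"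
    using inverse_power_summable[of n, where 'a = real] assms by (simp add: inverse_eq_divide)
  thus "summable (\<lambda>k. 1 / real (Suc k) ^ n)"
    by (subst summable_Suc_iff)
  show "norm (1 / freq k ^ n) \<le> 1 / real (Suc k) ^ n" if "k \<ge> 0" for k
    using freq_ge[of k] freq_pos[of k]
    by (auto simp: power_abs divide_simps simp del: of_nat_Suc intro!: power_mono)
qed

section \<open>Fourier series with Euler polynomial values\<close>

text \<open>
  Multiplication by \<open>cos (\<pi> v / 2)\<close> makes the sum telescope, because the frequencies are \<open>\<pi>\<close> apart.
  Up to sign, the sum is the derivative of the partial sums of the square wave.
\<close>
lemma dirichlet_kernel_freq:
  "cos (pi * v / 2) * (\<Sum>k<n. 2 * (-1) ^ k * sin (freq k * v)) = (-1) ^ (n + 1) * sin (pi * n * v)"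
proof (induction n)
  case (Suc n)
  have *: "2 * (sin (freq n * v) * cos (pi * v / 2)) = sin (pi * (Suc n) * v) + sin (pi * n * v)"
  proof -
    have "freq n * v + pi * v / 2 = pi * (Suc n) * v" "freq n * v - pi * v / 2 = pi * n * v"
      by (simp_all add: freq_def field_simps)
    thus ?thesis by (simp add: sin_times_cos)
  qed
  have "cos (pi * v / 2) * (\<Sum>k<Suc n. 2 * (-1) ^ k * sin (freq k * v)) =
          (-1) ^ (n + 1) * sin (pi * n * v) + (-1) ^ n * (2 * (sin (freq n * v) * cos (pi * v / 2)))"
    unfolding sum.lessThan_Suc distrib_left Suc.IH by simp
  also have "\<dots> = (-1) ^ (Suc n + 1) * sin (pi * (Suc n) * v)"
    unfolding * by (simp add: ring_distribs)
  finally show ?case .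
qed auto

lemma leibniz_freq: "(\<lambda>k. 2 * (-1) ^ k / freq k) sums 1"
proof -
  have "summable (\<lambda>k. (-1) ^ k * (1 / real (k*2+1) * 1 ^ (k*2+1)))"
    by (rule summable_arctan_series) auto
  hence "(\<lambda>k. (-1) ^ k * 1 / real (k*2+1)) sums (pi / 4)"
    unfolding pi_series by (intro summable_sums) (simp add: field_simps)
  from sums_mult[OF this, of "4 / pi"] show ?thesis
    by (simp add: freq_def field_simps)
qed

text \<open>
  The derivative of the partial sum \<open>D n\<close> is \<open>\<plusminus> sin (\<pi> n v) / cos (\<pi> v / 2)\<close>, which oscillates without becoming small.
  Away from \<open>v = 1\<close>, integrating it by parts gains a factor \<open>1 / n\<close>. Hence \<open>D n v\<close> is uniformly close to
  \<open>D n 0\<close>, which converges to 1 by Leibniz's series for \<open>\<pi> / 4\<close>.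
\<close>
lemma uniform_limit_square_wave:
  assumes "0 \<le> b" "b < 1"
  shows "uniform_limit {0..b} (\<lambda>n v. \<Sum>k<n. 2 * (-1) ^ k * cos (freq k * v) / freq k) (\<lambda>_. 1)
           sequentially"
proof -
  define D where "D = (\<lambda>n v. \<Sum>k<n. 2 * (-1) ^ k * cos (freq k * v) / freq k)"
  define s where "s = (\<lambda>v. 1 / cos (pi * v / 2))"
  define s' where "s' = (\<lambda>v. pi / 2 * sin (pi * v / 2) / cos (pi * v / 2) ^ 2)"
  define c0 where "c0 = cos (pi * b / 2)"
  have c0: "c0 > 0"
  proof -
    have "0 \<le> pi * b" "pi * b < pi" using assms by auto
    thus ?thesis unfolding c0_def using pi_gt_zero by (intro cos_gt_zero_pi) linarith+
  qed
  have cos_ge: "cos (pi * v / 2) \<ge> c0" if "v \<in> {0..b}" for v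
    unfolding c0_def using that assms
    by (intro cos_monotone_0_pi_le) (auto simp: field_simps mult_le_cancel_left intro: order.trans[of _ 1])
  \<comment> \<open>The correction is the boundary term of the integration by parts: the derivative of \<open>W n\<close> is
    of order \<open>1 / n\<close>.\<close>
  define W where "W = (\<lambda>n v. D n v + (-1) ^ n * cos (pi * n * v) / (pi * n) * s v)"
  define C where "C = 1 / c0 ^ 2"
  have s_bound: "\<bar>s v\<bar> \<le> 1 / c0" if "v \<in> {0..b}" for v
    using cos_ge[OF that] c0 by (auto simp: s_def divide_simps)
  have s'_bound: "\<bar>s' v\<bar> \<le> pi / 2 * C" if "v \<in> {0..b}" for v
  proof -
    have "c0 ^ 2 \<le> cos (pi * v / 2) ^ 2"
      using cos_ge[OF that] c0 by (intro power_mono) auto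
    thus ?thesis using c0
      unfolding s'_def C_def abs_divide abs_mult times_divide_eq_right
      by (intro frac_le) (auto intro!: mult_left_le)
  qed
  have DW: "(W n has_field_derivative (-1) ^ n * cos (pi * n * v) / (pi * n) * s' v) (at v within {0..b})"
    if v: "v \<in> {0..b}" and n: "n > 0" for n v
  proof -
    have nz: "cos (pi * v / 2) \<noteq> 0" using cos_ge[OF v] c0 by auto
    have dD: "(D n has_field_derivative -(\<Sum>k<n. 2 * (-1) ^ k * sin (freq k * v))) (at v within {0..b})"
      unfolding D_def sum_negf[symmetric]
      by (intro DERIV_sum) (auto intro!: derivative_eq_intros)
    have ds: "(s has_field_derivative s' v) (at v within {0..b})"
      unfolding s_def s'_def using nz
      by (auto intro!: derivative_eq_intros simp: field_simps power2_eq_square)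
    have dc: "((\<lambda>v. (-1) ^ n * cos (pi * n * v) / (pi * n)) has_field_derivative
                 - ((-1) ^ n * sin (pi * n * v))) (at v within {0..b})"
      using n by (auto intro!: derivative_eq_intros)
    have eq: "(\<Sum>k<n. 2 * (-1) ^ k * sin (freq k * v)) = - ((-1) ^ n * sin (pi * n * v)) * s v"
      using dirichlet_kernel_freq[of v n] nz by (simp add: s_def field_simps)
    show ?thesis
      unfolding W_def
      by (rule DERIV_cong[OF DERIV_add[OF dD DERIV_mult[OF dc ds]]]) (simp add: eq)
  qed
  have W_bound: "\<bar>W n v - W n 0\<bar> \<le> C / n" if v: "v \<in> {0..b}" and n: "n > 0" for n v
  proof -
    have "norm (W n v - W n 0) \<le> (C / 2 / n) * norm (v - 0)"
    proof (rule field_differentiable_bound[where S = "{0..b}"])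
      fix z assume z: "z \<in> {0..b}"
      show "(W n has_field_derivative (-1) ^ n * cos (pi * n * z) / (pi * n) * s' z) (at z within {0..b})"
        using DW z n by blast
      have "norm ((-1) ^ n * cos (pi * n * z) / (pi * n) * s' z) = \<bar>cos (pi * n * z)\<bar> * \<bar>s' z\<bar> / (pi * n)"
        by (simp add: abs_mult)
      also have "\<dots> \<le> 1 * (pi / 2 * C) / (pi * n)"
        using s'_bound[OF z] n by (intro divide_right_mono mult_mono) auto
      finally show "norm ((-1) ^ n * cos (pi * n * z) / (pi * n) * s' z) \<le> C / 2 / n"
        using n by (simp add: field_simps)
    qed (use v assms in auto)
    also have "\<dots> \<le> (C / 2 / n) * 2"
      using v assms c0 by (intro mult_left_mono) (auto simp: C_def)
    finally show ?thesis by simp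
  qed
  define K where "K = C + 2 / c0"
  have D_bound: "\<bar>D n v - D n 0\<bar> \<le> K / n" if v: "v \<in> {0..b}" and n: "n > 0" for n v
  proof -
    have aux: "\<bar>(-1) ^ n * cos (pi * n * u) / (pi * n) * s u\<bar> \<le> 1 / c0 / n" if "u \<in> {0..b}" for u
    proof -
      have "\<bar>(-1) ^ n * cos (pi * n * u) / (pi * n) * s u\<bar> = \<bar>cos (pi * n * u)\<bar> * \<bar>s u\<bar> / (pi * n)"
        by (simp add: abs_mult)
      also have "\<dots> \<le> 1 * (1 / c0) / (1 * n)"
        using s_bound[OF that] n c0 pi_ge_two
        by (intro frac_le mult_mono mult_right_mono) auto
      finally show ?thesis by simp
    qed
    have "\<bar>D n v - D n 0\<bar> \<le> \<bar>W n v - W n 0\<bar> + 1 / c0 / n + 1 / c0 / n"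
      using aux[OF v] aux[of 0] assms unfolding W_def by (simp add: abs_if split: if_splits)
    also have "\<dots> \<le> C / n + 1 / c0 / n + 1 / c0 / n"
      using W_bound[OF v n] by simp
    finally show ?thesis by (simp add: K_def add_divide_distrib)
  qed
  have D0: "(\<lambda>n. D n 0) \<longlonglongrightarrow> 1"
    using leibniz_freq by (simp add: D_def sums_def)
  have "uniform_limit {0..b} D (\<lambda>_. 1) sequentially"
  proof (rule uniform_limitI)
    fix e :: real assume e: "e > 0"
    have "(\<lambda>n. K / real n + \<bar>D n 0 - 1\<bar>) \<longlonglongrightarrow> 0 + \<bar>1 - 1\<bar>"
      by (intro tendsto_intros lim_const_over_n D0)
    hence "\<forall>\<^sub>F n in sequentially. K / real n + \<bar>D n 0 - 1\<bar> < e"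
      using e by (auto dest: order_tendstoD(2)[where a = e])
    thus "\<forall>\<^sub>F n in sequentially. \<forall>v\<in>{0..b}. dist (D n v) 1 < e"
      using eventually_gt_at_top[of 0]
    proof eventually_elim
      case (elim n)
      show ?case
      proof
        fix v assume "v \<in> {0..b}"
        from D_bound[OF this elim(2)] elim(1) show "dist (D n v) 1 < e"
          by (simp add: dist_real_def abs_if split: if_splits)
      qed
    qed
  qed
  thus ?thesis by (simp add: D_def)
qed

definition sech_coeff :: "nat \<Rightarrow> real" where
  "sech_coeff j = euler_number (2 * j) / fact (2 * j)"

lemma sech_coeff_0 [simp]: "sech_coeff 0 = 1"
  by (simp add: sech_coeff_def euler_number_0)

text \<open>
  The coefficient of \<open>x\<^bsup>2m\<^esup>\<close> in \<open>cosh x \<cdot> (1 / cosh x) = 1\<close>. It says that \<open>wave_poly m\<close> vanishes at 1, and it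
  makes Euler's constant disappear from the digamma values.
\<close>
lemma sech_coeff_recurrence:
  assumes "m \<ge> 1"
  shows "(\<Sum>j\<le>m. sech_coeff j / fact (2 * m - 2 * j)) = 0"
proof -
  have "0 = fps_nth (Abs_fps (\<lambda>n. euler_number n / fact n) * fps_cosh) (2 * m)"
    using assms by (simp add: euler_number_gf)
  also have "\<dots> = (\<Sum>i\<le>2*m. euler_number i / fact i * fps_nth fps_cosh (2 * m - i))"
    by (simp add: fps_mult_nth atLeast0AtMost)
  also have "\<dots> = (\<Sum>i\<in>(\<lambda>j. 2 * j) ` {..m}. euler_number i / fact i * fps_nth fps_cosh (2 * m - i))"
    by (intro sum.mono_neutral_right)
       (auto simp: fps_cosh_nth image_iff elim!: evenE)
  also have "\<dots> = (\<Sum>j\<le>m. sech_coeff j / fact (2 * m - 2 * j))"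
    by (subst sum.reindex) (auto simp: inj_on_def sech_coeff_def fps_cosh_nth mult.commute)
  finally show ?thesis by simp
qed

text \<open>
  The polynomial that agrees on \<open>[0, 1]\<close> with the series of
  \<open>2 (-1)\<^sup>k cos (a\<^sub>k v) / a\<^sub>k\<^bsup>2m+1\<^esup>\<close>; it is an Euler polynomial up to affine substitution and a scalar factor.
\<close>
definition wave_poly :: "nat \<Rightarrow> real \<Rightarrow> real" where
  "wave_poly m v = (-1) ^ m * (\<Sum>j\<le>m. sech_coeff j * v ^ (2 * m - 2 * j) / fact (2 * m - 2 * j))"

definition wave_poly_antideriv :: "nat \<Rightarrow> real \<Rightarrow> real" where
  "wave_poly_antideriv m v = (-1) ^ m * (\<Sum>j\<le>m. sech_coeff j * v ^ (2 * m - 2 * j + 1) / fact (2 * m - 2 * j + 1))"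

lemma wave_poly_0 [simp]: "wave_poly 0 v = 1"
  by (simp add: wave_poly_def)

lemma wave_poly_at_0: "wave_poly m 0 = (-1) ^ m * sech_coeff m"
proof -
  have "(\<Sum>j\<le>m. sech_coeff j * 0 ^ (2 * m - 2 * j) / fact (2 * m - 2 * j)) = 
        (\<Sum>j\<in>{m}. sech_coeff j * 0 ^ (2 * m - 2 * j) / fact (2 * m - 2 * j))"
    by (intro sum.mono_neutral_right) (auto simp: power_0_left)
  thus ?thesis by (simp add: wave_poly_def)
qed

lemma wave_poly_at_1: "m \<ge> 1 \<Longrightarrow> wave_poly m 1 = 0"
  using sech_coeff_recurrence[of m] by (simp add: wave_poly_def)

lemma wave_poly_antideriv_at_0: "wave_poly_antideriv m 0 = 0"
  by (simp add: wave_poly_antideriv_def)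

lemma DERIV_wave_poly_antideriv: "(wave_poly_antideriv m has_field_derivative wave_poly m v) (at v within S)"
proof -
  have "((\<lambda>v. v ^ Suc n / fact (Suc n)) has_field_derivative v ^ n / fact n) (at v within S)" for n
    by (rule derivative_eq_intros refl | simp del: power_Suc)+
  from DERIV_cmult[OF this]
  have *: "((\<lambda>v. sech_coeff j * v ^ (2 * m - 2 * j + 1) / fact (2 * m - 2 * j + 1)) has_field_derivative
          sech_coeff j * v ^ (2 * m - 2 * j) / fact (2 * m - 2 * j)) (at v within S)" for j
    by (simp only: Suc_eq_plus1[symmetric] times_divide_eq_right)
  show ?thesis unfolding wave_poly_antideriv_def[abs_def] wave_poly_def
    by (intro DERIV_cmult DERIV_sum *)
qed

lemma DERIV_wave_poly: "(wave_poly (Suc m) has_field_derivative - wave_poly_antideriv m v) (at v within S)"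
proof -
  have "((\<lambda>v. v ^ Suc n / fact (Suc n)) has_field_derivative v ^ n / fact n) (at v within S)" for n
    by (rule derivative_eq_intros refl | simp del: power_Suc)+
  from DERIV_cmult[OF this]
  have *: "((\<lambda>v. sech_coeff j * v ^ Suc n / fact (Suc n)) has_field_derivative
          sech_coeff j * v ^ n / fact n) (at v within S)" for j n
    by (simp only: times_divide_eq_right)
  have eq: "wave_poly (Suc m) = (\<lambda>v. (-1) ^ Suc m * ((\<Sum>j\<le>m. sech_coeff j * v ^ Suc (2 * m - 2 * j + 1) /
              fact (Suc (2 * m - 2 * j + 1))) + sech_coeff (Suc m)))"
  proof
    fix v
    have "2 * Suc m - 2 * j = Suc (2 * m - 2 * j + 1)" if "j \<le> m" for j
      using that by simp
    hence "(\<Sum>j\<le>m. sech_coeff j * v ^ (2 * Suc m - 2 * j) / fact (2 * Suc m - 2 * j)) =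
           (\<Sum>j\<le>m. sech_coeff j * v ^ Suc (2 * m - 2 * j + 1) / fact (Suc (2 * m - 2 * j + 1)))"
      by (intro sum.cong) (simp_all only: atMost_iff)
    thus "wave_poly (Suc m) v = (-1) ^ Suc m * ((\<Sum>j\<le>m. sech_coeff j * v ^ Suc (2 * m - 2 * j + 1) /
              fact (Suc (2 * m - 2 * j + 1))) + sech_coeff (Suc m))"
      unfolding wave_poly_def by (simp only: sum.atMost_Suc) simp
  qed
  show ?thesis unfolding eq wave_poly_antideriv_def
    by (rule DERIV_cong[OF DERIV_cmult[OF DERIV_add[OF DERIV_sum[OF *] DERIV_const]]]) simp
qed

text \<open>
  The second derivative of the series for \<open>m + 1\<close> is minus the series for \<open>m\<close>, and the same relation holds between the
  polynomials. The two constants of integration agree because both functions have derivative 0 at \<open>v = 0\<close>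
  and value 0 at \<open>v = 1\<close>. For the square wave, uniform convergence is
  available only on \<open>[0, b]\<close> with \<open>b < 1\<close>, so the endpoint 1 is reached by continuity.
\<close>
lemma sums_wave_poly_step:
  assumes UL: "\<And>b. 0 \<le> b \<Longrightarrow> b < 1 \<Longrightarrow> uniform_limit {0..b}
            (\<lambda>n v. \<Sum>k<n. 2 * (-1) ^ k * cos (freq k * v) / freq k ^ (2 * m + 1)) (wave_poly m) sequentially"
  shows "\<And>v. v \<in> {0..1} \<Longrightarrow>
           (\<lambda>k. 2 * (-1) ^ k * cos (freq k * v) / freq k ^ (2 * Suc m + 1)) sums wave_poly (Suc m) v"
    and "uniform_limit {0..1}
            (\<lambda>n v. \<Sum>k<n. 2 * (-1) ^ k * cos (freq k * v) / freq k ^ (2 * Suc m + 1))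
            (wave_poly (Suc m)) sequentially"
proof -
  define f where "f = (\<lambda>k v. 2 * (-1) ^ k * cos (freq k * v) / freq k ^ (2 * Suc m + 1))"
  define f' where "f' = (\<lambda>k v. - (2 * (-1) ^ k * sin (freq k * v) / freq k ^ (2 * m + 2)))"
  define f'' where "f'' = (\<lambda>k v. 2 * (-1) ^ k * cos (freq k * v) / freq k ^ (2 * m + 1))"
  have df: "(f k has_field_derivative f' k v) (at v within S)" for k v S
    unfolding f_def f'_def by (auto intro!: derivative_eq_intros simp: field_simps)
  have df': "((\<lambda>v. - f' k v) has_field_derivative f'' k v) (at v within S)" for k v S
    unfolding f''_def f'_def by (auto intro!: derivative_eq_intros simp: field_simps)
  have sumbd: "summable (\<lambda>k. 2 * (1 / freq k ^ n))" if "n \<ge> 2" for n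
    by (intro summable_mult summable_inverse_freq_power that)
  have f_bound: "norm (f k v) \<le> 2 * (1 / freq k ^ (2 * Suc m + 1))" for k v
    unfolding f_def using freq_pos[of k] by (auto simp: abs_mult power_abs divide_simps)
  have f'_bound: "norm (f' k v) \<le> 2 * (1 / freq k ^ (2 * m + 2))" for k v
    unfolding f'_def using freq_pos[of k] by (auto simp: abs_mult power_abs divide_simps)
  define F where "F = (\<lambda>v. \<Sum>k. f k v)"
  define F' where "F' = (\<lambda>v. \<Sum>k. f' k v)"
  have ULf: "uniform_limit UNIV (\<lambda>n v. \<Sum>k<n. f k v) F sequentially"
    unfolding F_def by (intro Weierstrass_m_test[OF f_bound] sumbd) auto
  have ULf': "uniform_limit UNIV (\<lambda>n v. \<Sum>k<n. f' k v) F' sequentially"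
    unfolding F'_def
    by (rule Weierstrass_m_test[OF f'_bound]) (use sumbd[of "2 * m + 2"] in simp)
  have sumf: "(\<lambda>k. f k v) sums F v" for v
    unfolding F_def by (rule summable_sums, rule summable_comparison_test'[OF sumbd f_bound]) auto
  have sumf': "(\<lambda>k. f' k v) sums F' v" for v
    unfolding F'_def by (rule summable_sums, rule summable_comparison_test'[OF _ f'_bound])
      (use sumbd[of "2 * m + 2"] in simp)
  have contF: "continuous_on UNIV F"
    by (rule uniform_limit_theorem[OF _ ULf])
       (auto intro!: always_eventually continuous_intros simp: f_def)
  have F'_eq: "F' v = - wave_poly_antideriv m v" if v: "v \<in> {0..<1}" for v
  proof -
    have "\<exists>g. \<forall>x\<in>{0..v}. (\<lambda>k. - f' k x) sums g x \<and>
                (g has_field_derivative wave_poly m x) (at x within {0..v})"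
    proof (rule has_field_derivative_series[where f' = f'' and ?x0.0 = 0])
      show "uniform_limit {0..v} (\<lambda>n x. \<Sum>i<n. f'' i x) (wave_poly m) sequentially"
        using UL[of v] v by (simp add: f''_def)
      show "summable (\<lambda>k. - f' k 0)" by (simp add: f'_def)
      show "((\<lambda>v. - f' k v) has_field_derivative f'' k x) (at x within {0..v})" for k x
        by (rule df')
    qed (use v in auto)
    then obtain g where g: "\<And>x. x \<in> {0..v} \<Longrightarrow> (\<lambda>k. - f' k x) sums g x"
        "\<And>x. x \<in> {0..v} \<Longrightarrow> (g has_field_derivative wave_poly m x) (at x within {0..v})"
      by blast
    have "\<exists>c. \<forall>x\<in>{0..v}. g x - wave_poly_antideriv m x = c"
    proof (rule has_field_derivative_zero_constant)
      fix x assume "x \<in> {0..v}"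
      from DERIV_diff[OF g(2)[OF this] DERIV_wave_poly_antideriv[of m]]
      show "((\<lambda>x. g x - wave_poly_antideriv m x) has_field_derivative 0) (at x within {0..v})" by simp
    qed auto
    then obtain c where c: "\<And>x. x \<in> {0..v} \<Longrightarrow> g x - wave_poly_antideriv m x = c" by blast
    have "g 0 = 0"
      using g(1)[of 0] v by (simp add: f'_def sums_iff)
    hence "c = 0" using c[of 0] v by (simp add: wave_poly_antideriv_at_0)
    hence "g v = wave_poly_antideriv m v" using c[of v] v by simp
    moreover have "g v = - F' v"
      by (rule sums_unique2[OF g(1) sums_minus[OF sumf']]) (use v in auto)
    ultimately show ?thesis by simp
  qed
  have "\<exists>g. \<forall>x\<in>UNIV. (\<lambda>k. f k x) sums g x \<and> (g has_field_derivative F' x) (at x)"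
    by (rule has_field_derivative_series[where ?x0.0 = 0, OF _ df ULf'])
       (use sumf[of 0] in \<open>auto simp: sums_iff\<close>)
  then obtain g where "\<And>x. (\<lambda>k. f k x) sums g x" "\<And>x. (g has_field_derivative F' x) (at x)"
    by blast
  moreover have "g x = F x" for x
    by (rule sums_unique2[OF calculation(1) sumf])
  hence "g = F" by (rule ext)
  ultimately have dF: "(F has_field_derivative F' x) (at x)" for x by simp
  have cont_poly: "continuous_on UNIV (wave_poly (Suc m))"
    using DERIV_wave_poly by (intro DERIV_continuous_on)
  have "\<exists>c. \<forall>x\<in>{0..<1}. F x - wave_poly (Suc m) x = c"
  proof (rule has_field_derivative_zero_constant)
    fix x :: real assume "x \<in> {0..<1}"
    with DERIV_diff[OF has_field_derivative_at_within[OF dF[of x]] DERIV_wave_poly[of m]]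
    show "((\<lambda>x. F x - wave_poly (Suc m) x) has_field_derivative 0) (at x within {0..<1})"
      by (simp add: F'_eq)
  qed auto
  then obtain c where c: "\<And>x. x \<in> {0..<1} \<Longrightarrow> F x - wave_poly (Suc m) x = c" by blast
  have "continuous_on (closure {0..<1}) (\<lambda>x. F x - wave_poly (Suc m) x)"
    using contF cont_poly by (intro continuous_on_diff) (auto elim: continuous_on_subset)
  from continuous_constant_on_closure[OF this c]
  have c'': "F x - wave_poly (Suc m) x = c" if "x \<in> {0..1}" for x
    using that by simp
  have "F 1 = 0"
    using sumf[of 1] by (simp add: f_def sums_iff)
  hence "c = 0" using c''[of 1] by (simp add: wave_poly_at_1)
  hence eq: "F x = wave_poly (Suc m) x" if "x \<in> {0..1}" for x
    using c''[OF that] by simp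
  show "(\<lambda>k. 2 * (-1) ^ k * cos (freq k * v) / freq k ^ (2 * Suc m + 1)) sums wave_poly (Suc m) v"
    if "v \<in> {0..1}" for v
    using sumf[of v] eq[OF that] by (simp add: f_def)
  have "uniform_limit {0..1} (\<lambda>n v. \<Sum>k<n. f k v) F sequentially"
    by (rule uniform_limit_on_subset[OF ULf]) auto
  also have "?this \<longleftrightarrow> uniform_limit {0..1} (\<lambda>n v. \<Sum>k<n. f k v) (wave_poly (Suc m)) sequentially"
    by (rule uniform_limit_cong') (simp_all add: eq)
  finally show "uniform_limit {0..1}
            (\<lambda>n v. \<Sum>k<n. 2 * (-1) ^ k * cos (freq k * v) / freq k ^ (2 * Suc m + 1))
            (wave_poly (Suc m)) sequentially"
    by (simp add: f_def)
qed

lemma sums_wave_poly: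
  assumes "m \<ge> 1" "v \<in> {0..1}"
  shows "(\<lambda>k. 2 * (-1) ^ k * cos (freq k * v) / freq k ^ (2 * m + 1)) sums wave_poly m v"
proof -
  have UL: "uniform_limit {0..b} (\<lambda>n v. \<Sum>k<n. 2 * (-1) ^ k * cos (freq k * v) / freq k ^ (2 * m + 1))
             (wave_poly m) sequentially" if "0 \<le> b" "b < 1" for m b
    using that
  proof (induction m arbitrary: b)
    case 0
    have "wave_poly 0 = (\<lambda>_. 1)" by auto
    thus ?case using uniform_limit_square_wave[OF 0] by simp
  next
    case (Suc m)
    show ?case
      by (rule uniform_limit_on_subset[OF sums_wave_poly_step(2)[OF Suc.IH]]) (use Suc.prems in auto)
  qed
  obtain m' where m': "m = Suc m'" using assms by (cases m) auto
  show ?thesis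
    unfolding m' by (rule sums_wave_poly_step(1)[OF UL]) (use assms in auto)
qed

text \<open>
  The Fourier series at \<open>v = 0\<close>; equivalently, the partial fraction expansion of \<open>1 / cosh\<close> at the origin.
\<close>
lemma sums_sech_coeff: "(\<lambda>k. 2 * (-1) ^ k / freq k ^ (2 * j + 1)) sums ((-1) ^ j * sech_coeff j)"
proof (cases "j = 0")
  case True
  thus ?thesis using leibniz_freq by simp
next
  case False
  thus ?thesis using sums_wave_poly[of j 0] by (simp add: wave_poly_at_0)
qed

section \<open>The sine integral at the frequencies\<close>

text \<open>
  By \<open>Si(a) = \<integral>\<^sub>0\<^sup>1 sin (a u) / u du\<close>, the sum is the integral of \<open>wave_poly m (1 - u) / u\<close> over \<open>[0, 1]\<close>. As
  \<open>wave_poly m 1 = 0\<close>, each power \<open>(1 - u)\<^sup>n\<close> may be replaced by \<open>(1 - u)\<^sup>n - 1\<close>, and division by \<open>u\<close> then leaves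
  minus a geometric sum with integral \<open>- H\<^sub>n\<close>.
\<close>
lemma sums_Si_freq:
  assumes m: "m \<ge> 1"
  shows "(\<lambda>k. 2 * Si (freq k) / freq k ^ (2 * m + 1)) sums
           ((-1) ^ (m + 1) * (\<Sum>j\<le>m. sech_coeff j * harm (2 * m - 2 * j) / fact (2 * m - 2 * j)))"
proof -
  define g where "g = (\<lambda>k u. indicator {0<..<1::real} u * (2 * sin (u * freq k) / u / freq k ^ (2 * m + 1)))"
  have int_g: "(\<integral>u. g k u \<partial>lborel) = 2 * Si (freq k) / freq k ^ (2 * m + 1)" for k
  proof -
    have "Si (freq k) = LBINT u=0..1. sin (u * freq k) / u"
      using LBINT_I0c_sin_scale_divide[of 1 "freq k"] by (simp add: one_ereal_def)
    also have "\<dots> = (LBINT u. indicator {0<..<1} u * (sin (u * freq k) / u))"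
      by (simp add: interval_lebesgue_integral_def set_lebesgue_integral_def zero_ereal_def one_ereal_def)
    finally have "2 / freq k ^ (2 * m + 1) * (LBINT u. indicator {0<..<1} u * (sin (u * freq k) / u)) =
       2 / freq k ^ (2 * m + 1) * Si (freq k)" by simp
    thus ?thesis
      unfolding g_def by (subst (asm) Bochner_Integration.integral_mult_right_zero[symmetric])
        (simp add: field_simps)
  qed
  \<comment> \<open>The bound \<open>\<bar>sin (a u)\<bar> \<le> a u\<close> costs one power of \<open>a\<^sub>k\<close>; \<open>m \<ge> 1\<close> leaves a summable series.\<close>
  have g_bound: "norm (g k u) \<le> indicator {0<..<1} u * (2 * (1 / freq k ^ (2 * m)))" for k u
  proof (cases "u \<in> {0<..<1}")
    case True
    have "\<bar>sin (u * freq k)\<bar> \<le> u * freq k"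
      using abs_sin_x_le_abs_x[of "u * freq k"] True by (simp add: abs_mult)
    hence "\<bar>sin (u * freq k)\<bar> / u \<le> freq k"
      using True by (simp add: field_simps)
    hence "2 * (\<bar>sin (u * freq k)\<bar> / u) / freq k ^ (2 * m + 1) \<le> 2 * freq k / freq k ^ (2 * m + 1)"
      using freq_pos[of k] by (intro divide_right_mono mult_left_mono) (simp_all add: less_imp_le)
    also have "\<dots> = 2 * (1 / freq k ^ (2 * m))" by simp
    finally show ?thesis using True by (simp add: g_def abs_mult power_abs)
  qed (simp add: g_def)
  have int_ind: "integrable lborel (\<lambda>u::real. indicator {0<..<1} u * (c::real))" for c
    by (intro integrable_mult_left) (auto simp: integrable_indicator_iff)
  have g_meas [measurable]: "g k \<in> borel_measurable lborel" for k
    unfolding g_def by measurable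
  have integrable_g: "integrable lborel (g k)" for k
  proof (rule Bochner_Integration.integrable_bound[OF int_ind[of "2 * (1 / freq k ^ (2 * m))"]])
    show "AE u in lborel. norm (g k u) \<le> norm (indicator {0<..<1} u * (2 * (1 / freq k ^ (2 * m))))"
      using order.trans[OF g_bound[of k] abs_ge_self] by (intro AE_I2) (simp only: real_norm_def)
  qed measurable
  have "(\<lambda>k. \<integral>u. g k u \<partial>lborel) sums (\<integral>u. (\<Sum>k. g k u) \<partial>lborel)"
  proof (rule sums_integral)
    show "integrable lborel (g k)" for k by (rule integrable_g)
    have *: "summable (\<lambda>k. c * (2 * (1 / freq k ^ (2 * m))))" for c
      using m by (intro summable_mult summable_inverse_freq_power) auto
    show "AE u in lborel. summable (\<lambda>k. norm (g k u))"
      by (intro AE_I2 summable_comparison_test'[OF *]) (use g_bound in auto)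
    show "summable (\<lambda>k. \<integral>u. norm (g k u) \<partial>lborel)"
    proof (rule summable_comparison_test'[OF *[of 1]])
      fix k :: nat
      have "norm (\<integral>u. norm (g k u) \<partial>lborel) = (\<integral>u. norm (g k u) \<partial>lborel)"
        by (simp add: integral_nonneg_AE)
      also have "\<dots> \<le> (\<integral>u. indicator {0<..<1::real} u * (2 * (1 / freq k ^ (2 * m))) \<partial>lborel)"
        by (rule Bochner_Integration.integral_mono[OF integrable_norm[OF integrable_g] int_ind g_bound])
      also have "\<dots> = 1 * (2 * (1 / freq k ^ (2 * m)))"
        by (subst integral_mult_left_zero) simp
      finally show "norm (\<integral>u. norm (g k u) \<partial>lborel) \<le> 1 * (2 * (1 / freq k ^ (2 * m)))" .
    qed
  qed
  also have "(\<integral>u. (\<Sum>k. g k u) \<partial>lborel) = (LBINT u:{0..1}. wave_poly m (1 - u) / u)"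
    unfolding set_lebesgue_integral_def
  proof (rule integral_cong_AE)
    show "(\<lambda>u. \<Sum>k. g k u) \<in> borel_measurable lborel" by measurable
    have [measurable]: "(\<lambda>u. wave_poly m (1 - u)) \<in> borel_measurable borel"
      unfolding wave_poly_def by measurable
    show "(\<lambda>u. indicat_real {0..1} u *\<^sub>R (wave_poly m (1 - u) / u)) \<in> borel_measurable lborel"
      by measurable
    show "AE u in lborel. (\<Sum>k. g k u) = indicat_real {0..1} u *\<^sub>R (wave_poly m (1 - u) / u)"
      using AE_lborel_singleton[of 0] AE_lborel_singleton[of 1]
    proof eventually_elim
      case (elim u)
      show ?case
      proof (cases "u \<in> {0..1}")
        case True
        have "sin (u * freq k) = (-1) ^ k * cos (freq k * (1 - u))" for k
          using sin_diff[of "freq k" "freq k * (1 - u)"] by (simp add: algebra_simps)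
        hence "g k u = 1 / u * (2 * (-1) ^ k * cos (freq k * (1 - u)) / freq k ^ (2 * m + 1))" for k
          using elim True by (simp add: g_def field_simps)
        moreover have "(\<lambda>k. 1 / u * (2 * (-1) ^ k * cos (freq k * (1 - u)) / freq k ^ (2 * m + 1))) sums
                (1 / u * wave_poly m (1 - u))"
          using True by (intro sums_mult sums_wave_poly m) auto
        ultimately show ?thesis using True by (simp add: sums_iff)
      qed (auto simp: g_def)
    qed
  qed
  also have "\<dots> = (-1) ^ (m + 1) * (\<Sum>j\<le>m. sech_coeff j * harm (2 * m - 2 * j) / fact (2 * m - 2 * j))"
  proof -
    define q where "q = (\<lambda>n u. \<Sum>i<n. (1 - u) ^ i :: real)"
    define Q where "Q = (\<lambda>n u. - (\<Sum>i<n. (1 - u) ^ Suc i / real (Suc i)))"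
    define r where "r = (\<lambda>u. (-1) ^ (m + 1) * (\<Sum>j\<le>m. sech_coeff j / fact (2 * m - 2 * j) * q (2 * m - 2 * j) u))"
    define R where "R = (\<lambda>u. (-1) ^ (m + 1) * (\<Sum>j\<le>m. sech_coeff j / fact (2 * m - 2 * j) * Q (2 * m - 2 * j) u))"
    have eq: "wave_poly m (1 - u) / u = r u" if "u \<noteq> 0" for u
    proof -
      have "u * q n u = 1 - (1 - u) ^ n" for n
        unfolding q_def using one_diff_power_eq[of "1 - u" n] by simp
      hence qn: "(1 - u) ^ n = 1 - u * q n u" for n by simp
      have "wave_poly m (1 - u) = (-1) ^ m * (\<Sum>j\<le>m. sech_coeff j / fact (2 * m - 2 * j) -
                u * (sech_coeff j / fact (2 * m - 2 * j) * q (2 * m - 2 * j) u))"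
        unfolding wave_poly_def qn by (intro arg_cong2[of _ _ _ _ "(*)"] refl sum.cong) (simp add: field_simps)
      also have "\<dots> = u * r u"
        unfolding sum_subtractf sum_distrib_left[symmetric] sech_coeff_recurrence[OF m] r_def by simp
      finally show ?thesis using that by simp
    qed
    have dQ: "(Q n has_field_derivative q n u) (at u within S)" for n u S
      unfolding Q_def q_def
      by (rule derivative_eq_intros refl | simp del: power_Suc of_nat_Suc)+
         (simp add: sum_negf[symmetric])
    have dR: "(R has_field_derivative r u) (at u within S)" for u S
      unfolding R_def r_def by (intro DERIV_cmult DERIV_sum dQ)
    have "(LBINT u:{0..1}. wave_poly m (1 - u) / u) = (LBINT u:{0..1}. r u)"
      unfolding set_lebesgue_integral_def
    proof (rule integral_cong_AE)
      show "AE u in lborel. indicat_real {0..1} u *\<^sub>R (wave_poly m (1 - u) / u) = indicat_real {0..1} u *\<^sub>R r u"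
        using AE_lborel_singleton[of 0] by eventually_elim (simp add: eq)
    qed (unfold wave_poly_def r_def q_def, measurable)
    also have "\<dots> = (LBINT u. r u * indicator {0..1} u)"
      by (simp add: set_lebesgue_integral_def mult.commute)
    also have "\<dots> = R 1 - R 0"
    proof (rule integral_FTC_Icc_real)
      show "(R has_real_derivative r u) (at u)" for u by (rule dR)
      show "isCont r u" for u unfolding r_def q_def by (intro continuous_intros)
    qed simp
    also have "R 1 = 0" by (simp add: R_def Q_def)
    also have "Q n 0 = - harm n" for n
      unfolding Q_def harm_def 
      by (simp add: sum.atLeast1_atMost_eq inverse_eq_divide lessThan_atLeast0 del: of_nat_Suc)
    hence "R 0 = - ((-1) ^ (m + 1) * (\<Sum>j\<le>m. sech_coeff j * harm (2 * m - 2 * j) / fact (2 * m - 2 * j)))"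
      by (simp add: R_def sum_negf)
    finally show ?thesis by simp
  qed
  finally show ?thesis by (simp add: int_g)
qed

lemma integrable_pair_bound:
  fixes f :: "real \<times> real \<Rightarrow> 'b :: {banach, second_countable_topology}"
  assumes [measurable]: "f \<in> borel_measurable (lborel \<Otimes>\<^sub>M lborel)"
    and g: "integrable lborel g" and h: "integrable lborel h"
    and bound: "\<And>x y. norm (f (x, y)) \<le> g x * h y"
  shows "integrable (lborel \<Otimes>\<^sub>M lborel) f"
proof (rule lborel_pair.Fubini_integrable)
  have int: "integrable lborel (\<lambda>y. f (x, y))" for x
    by (rule Bochner_Integration.integrable_bound[OF integrable_mult_right[OF h, of "g x"]])
       (use bound in \<open>auto intro: order.trans[OF _ abs_ge_self]\<close>)
  thus "AE x in lborel. integrable lborel (\<lambda>y. f (x, y))" by simp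
  have "(\<integral>y. norm (f (x, y)) \<partial>lborel) \<le> (\<integral>y. g x * h y \<partial>lborel)" for x
    by (intro Bochner_Integration.integral_mono integrable_norm int integrable_mult_right h bound)
  hence le: "(\<integral>y. norm (f (x, y)) \<partial>lborel) \<le> g x * (\<integral>y. h y \<partial>lborel)" for x
    by simp
  show "integrable lborel (\<lambda>x. \<integral>y. norm (f (x, y)) \<partial>lborel)"
  proof (rule Bochner_Integration.integrable_bound[OF integrable_mult_left[OF g, of "\<integral>y. h y \<partial>lborel"]])
    show "AE x in lborel. norm (\<integral>y. norm (f (x, y)) \<partial>lborel) \<le> norm (g x * (\<integral>y. h y \<partial>lborel))"
      by (intro AE_I2) (use le in \<open>auto simp: integral_nonneg_AE intro: order.trans[OF _ abs_ge_self]\<close>)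
  qed measurable
qed measurable

text \<open>
  Write \<open>1 / t = \<integral>\<^sub>0\<^sup>\<infinity> e\<^bsup>- u t\<^esup> du\<close> in \<open>\<integral>\<^sub>a\<^sup>b sin t / t dt\<close> and integrate over \<open>t\<close> first. Staying away from \<open>t = 0\<close>
  gives the integrable majorant \<open>e\<^bsup>- u a\<^esup>\<close>.
\<close>
lemma Si_diff_laplace:
  assumes a: "0 < a" "a \<le> b"
  shows "Si b - Si a = (LBINT u:{0<..}. exp (-(u * a)) * (u * sin a + cos a) / (1 + u\<^sup>2))
                     - (LBINT u:{0<..}. exp (-(u * b)) * (u * sin b + cos b) / (1 + u\<^sup>2))"
proof -
  define E where "E = (\<lambda>t u. exp (-(u * t)) * (u * sin t + cos t) / (1 + u\<^sup>2) :: real)"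
  have pos: "1 + u\<^sup>2 \<noteq> (0::real)" for u
    using zero_le_power2[of u] by linarith
  have int_E: "set_integrable lborel {0<..} (E t)" if "t > 0" for t
    using Si_at_top_integrable[of t] that
    by (simp add: E_def interval_lebesgue_integral_0_infty)
  define f where "f = (\<lambda>(t::real, u::real). (indicator {a..b} t * indicator {0<..} u) * (exp (-(u * t)) * sin t) :: real)"
  have [measurable]: "f \<in> borel_measurable (lborel \<Otimes>\<^sub>M lborel)"
    unfolding f_def by measurable
  have int_f: "integrable (lborel \<Otimes>\<^sub>M lborel) f"
  proof (rule integrable_pair_bound)
    show "integrable lborel (\<lambda>t. indicator {a..b} t :: real)"
      using emeasure_lborel_Icc_eq[of a b] by (simp add: integrable_indicator_iff)
    show "integrable lborel (\<lambda>u. indicator {0<..} u * exp (- (u * a)))"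
      using integrable_I0i_exp_mscale[OF a(1)] by (simp add: set_integrable_def)
    show "norm (f (t, u)) \<le> indicator {a..b} t * (indicator {0<..} u * exp (- (u * a)))" for t u
    proof (cases "t \<in> {a..b} \<and> u > 0")
      case True
      hence "exp (- (u * t)) * \<bar>sin t\<bar> \<le> exp (- (u * a)) * 1"
        by (intro mult_mono) auto
      thus ?thesis using True by (simp add: f_def abs_mult)
    qed (auto simp: f_def indicator_def)
  qed measurable
  have inner_u: "(\<integral>u. f (t, u) \<partial>lborel) = (sin t / t) * indicator {a..b} t" for t
  proof (cases "t \<in> {a..b}")
    case True
    have "(\<integral>u. f (t, u) \<partial>lborel) = (\<integral>u. sin t * (indicator {0<..} u *\<^sub>R exp (-(u * t))) \<partial>lborel)"
      using True by (intro Bochner_Integration.integral_cong) (auto simp: f_def)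
    also have "\<dots> = sin t * (1 / t)"
      using LBINT_I0i_exp_mscale[of t] True a
      by (simp add: interval_lebesgue_integral_0_infty set_lebesgue_integral_def)
    finally show ?thesis using True by simp
  qed (simp add: f_def)
  have outer_t: "(\<integral>t. (sin t / t) * indicator {a..b} t \<partial>lborel) = Si b - Si a"
  proof (rule integral_FTC_Icc_real)
    show "(Si has_real_derivative sin t / t) (at t)" if "a \<le> t" for t
      using DERIV_Si[of t] that a by auto
    show "isCont (\<lambda>t. sin t / t) t" if "a \<le> t" for t
      using that a by (auto intro!: continuous_intros)
  qed fact
  have inner_t: "(\<integral>t. f (t, u) \<partial>lborel) = indicator {0<..} u *\<^sub>R (E a u - E b u)" for u
  proof (cases "u > 0")
    case True
    have "(\<integral>t. f (t, u) \<partial>lborel) = (\<integral>t. (exp (-(u * t)) * sin t) * indicator {a..b} t \<partial>lborel)"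
      using True by (intro Bochner_Integration.integral_cong) (auto simp: f_def)
    also have "\<dots> = - E b u - (- E a u)"
    proof (rule integral_FTC_Icc_real)
      show "((\<lambda>t. - E t u) has_real_derivative exp (-(u * t)) * sin t) (at t)" for t
      proof -
        have "((\<lambda>t. - (1 / (1 + u\<^sup>2)) * (exp (-(u * t)) * (u * sin t + cos t))) has_real_derivative
                - (1 / (1 + u\<^sup>2)) * (exp (-(u * t)) * (u * cos t - sin t) +
                    - (u * exp (-(u * t))) * (u * sin t + cos t))) (at t)"
          by (intro DERIV_cmult DERIV_mult') (auto intro!: derivative_eq_intros)
        also have "exp (-(u * t)) * (u * cos t - sin t) + - (u * exp (-(u * t))) * (u * sin t + cos t) =
                     - (1 + u\<^sup>2) * (exp (-(u * t)) * sin t)"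
          by (simp add: algebra_simps power2_eq_square)
        also have "- (1 / (1 + u\<^sup>2)) * (- (1 + u\<^sup>2) * (exp (-(u * t)) * sin t)) = exp (-(u * t)) * sin t"
          using pos[of u] by (simp only: mult_minus_left minus_minus mult.assoc[symmetric]) simp
        finally show ?thesis by (simp add: E_def)
      qed
      show "isCont (\<lambda>t. exp (-(u * t)) * sin t) t" for t
        by (auto intro!: continuous_intros)
    qed fact
    finally show ?thesis using True by simp
  qed (simp add: f_def)
  have outer_u: "(\<integral>u. indicator {0<..} u *\<^sub>R (E a u - E b u) \<partial>lborel) =
               (LBINT u:{0<..}. E a u) - (LBINT u:{0<..}. E b u)"
    using set_integral_diff(2)[OF int_E[of a] int_E[of b]] a
    by (simp add: set_lebesgue_integral_def)
  have "(\<integral>u. (\<integral>t. f (t, u) \<partial>lborel) \<partial>lborel) = (\<integral>t. (\<integral>u. f (t, u) \<partial>lborel) \<partial>lborel)"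
    using lborel_pair.Fubini_integral[of "\<lambda>t u. f (t, u)"] int_f by simp
  thus ?thesis
    unfolding inner_u outer_t inner_t outer_u by (simp add: E_def)
qed

lemma Si_laplace:
  assumes a: "0 < a"
  shows "pi / 2 - Si a = (LBINT u:{0<..}. exp (-(u * a)) * (u * sin a + cos a) / (1 + u\<^sup>2))"
proof -
  define h :: "real \<Rightarrow> real" where "h = (\<lambda>t. LBINT u:{0<..}. exp (-(u * t)) * (u * sin t + cos t) / (1 + u\<^sup>2))"
  have "(h \<longlongrightarrow> 0) (at_top :: real filter)"
    using Si_at_top_LBINT by (simp add: h_def[abs_def] interval_lebesgue_integral_0_infty)
  from tendsto_add[OF Si_at_top this]
  have lim: "((\<lambda>t. Si t + h t) \<longlongrightarrow> pi / 2) at_top" by simp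
  have "\<forall>\<^sub>F t in at_top. Si t + h t = Si a + h a"
    using eventually_ge_at_top[of a]
    by eventually_elim (use Si_diff_laplace[OF a] in \<open>simp add: h_def algebra_simps\<close>)
  hence "((\<lambda>t. Si t + h t) \<longlongrightarrow> Si a + h a) at_top"
    by (rule tendsto_eventually)
  from tendsto_unique[OF _ lim this] show ?thesis by (simp add: h_def)
qed

text \<open>
  The moments \<open>S\<^sub>n(a)\<close>. Up to elementary factors, the Mellin-Barnes integrals below have these values.
\<close>
definition stieltjes :: "nat \<Rightarrow> real \<Rightarrow> real" where
  "stieltjes n a = (LBINT x:{0<..}. x ^ n * exp (-x) / (x\<^sup>2 + a\<^sup>2))"

lemma integrable_power_exp:
  "set_integrable lborel {0<..} (\<lambda>x::real. x ^ n * exp (-x))"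
  using has_bochner_integral_I0i_power_exp_m[of n]
  by (auto simp: set_integrable_def mult_ac dest: integrable.intros)

lemma integral_power_exp:
  "(LBINT x:{0<..}. x ^ n * exp (-x) :: real) = fact n"
  using has_bochner_integral_integral_eq[OF has_bochner_integral_I0i_power_exp_m[of n]]
  by (simp add: set_lebesgue_integral_def mult.commute mult.left_commute)

lemma integrable_stieltjes:
  fixes a :: real
  assumes "a > 0"
  shows "set_integrable lborel {0<..} (\<lambda>x. x ^ n * exp (-x) / (x\<^sup>2 + a\<^sup>2))"
  unfolding set_integrable_def
proof (rule Bochner_Integration.integrable_bound)
  show "integrable lborel (\<lambda>x. (indicator {0<..} x *\<^sub>R (x ^ n * exp (-x))) / a\<^sup>2)"
    using integrable_power_exp[of n] by (simp add: set_integrable_def)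
  show "AE x in lborel. norm (indicator {0<..} x *\<^sub>R (x ^ n * exp (-x) / (x\<^sup>2 + a\<^sup>2)))
          \<le> norm ((indicator {0<..} x *\<^sub>R (x ^ n * exp (-x))) / a\<^sup>2)"
  proof (intro AE_I2)
    fix x :: real
    show "norm (indicator {0<..} x *\<^sub>R (x ^ n * exp (-x) / (x\<^sup>2 + a\<^sup>2)))
          \<le> norm ((indicator {0<..} x *\<^sub>R (x ^ n * exp (-x))) / a\<^sup>2)"
    proof (cases "x > 0")
      case True
      hence "x ^ n * exp (-x) / (x\<^sup>2 + a\<^sup>2) \<le> x ^ n * exp (-x) / a\<^sup>2"
        using assms by (intro divide_left_mono) (auto intro!: add_pos_pos mult_pos_pos)
      thus ?thesis using True assms by (simp add: abs_mult power_abs)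
    qed simp
  qed
qed measurable

text \<open>
  From \<open>x\<^sup>2 / (x\<^sup>2 + a\<^sup>2) = 1 - a\<^sup>2 / (x\<^sup>2 + a\<^sup>2)\<close>.
\<close>
lemma stieltjes_rec:
  assumes "a > 0"
  shows "stieltjes (n + 2) a = fact n - a\<^sup>2 * stieltjes n a"
proof -
  have "stieltjes (n + 2) a =
         (LBINT x:{0<..}. x ^ n * exp (-x) - a\<^sup>2 * (x ^ n * exp (-x) / (x\<^sup>2 + a\<^sup>2)))"
    unfolding stieltjes_def
  proof (intro set_lebesgue_integral_cong allI impI)
    fix x :: real
    define D where "D = x\<^sup>2 + a\<^sup>2"
    have "D \<noteq> 0"
      using assms zero_le_power2[of x] zero_less_power2[of a] unfolding D_def by linarith
    have pow: "x ^ (n + 2) = x ^ n * (D - a\<^sup>2)" by (simp add: D_def power_add power2_eq_square)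
    show "x ^ (n + 2) * exp (-x) / (x\<^sup>2 + a\<^sup>2) = x ^ n * exp (-x) - a\<^sup>2 * (x ^ n * exp (-x) / (x\<^sup>2 + a\<^sup>2))"
      unfolding D_def[symmetric] pow using \<open>D \<noteq> 0\<close> by (simp add: field_simps)
  qed auto
  also have "\<dots> = fact n - a\<^sup>2 * stieltjes n a"
    unfolding stieltjes_def
    using set_integral_diff(2)[OF integrable_power_exp[of n]
            set_integrable_mult_right[OF integrable_stieltjes[OF assms, of n], of "a\<^sup>2"]]
    by (simp only: integral_power_exp set_integral_mult_right)
  finally show ?thesis .
qed

lemma stieltjes_1_scale:
  assumes a: "a > 0"
  shows "stieltjes 1 a = (LBINT u:{0<..}. exp (-(u * a)) * u / (1 + u\<^sup>2))"
proof -
  have "stieltjes 1 a = \<bar>a\<bar> *\<^sub>R (\<integral>u. indicator {0<..} (0 + a * u) *\<^sub>R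
           ((0 + a * u) ^ 1 * exp (-(0 + a * u)) / ((0 + a * u)\<^sup>2 + a\<^sup>2)) \<partial>lborel)"
    unfolding stieltjes_def set_lebesgue_integral_def
    by (rule lborel_integral_real_affine) (use a in auto)
  also have "\<dots> = (\<integral>u. a * (indicator {0<..} (0 + a * u) *\<^sub>R
           ((0 + a * u) ^ 1 * exp (-(0 + a * u)) / ((0 + a * u)\<^sup>2 + a\<^sup>2))) \<partial>lborel)"
    using a by (simp only: integral_mult_right_zero real_scaleR_def abs_of_pos)
  also have "\<dots> = (LBINT u:{0<..}. exp (-(u * a)) * u / (1 + u\<^sup>2))"
    unfolding set_lebesgue_integral_def
  proof (intro Bochner_Integration.integral_cong refl)
    fix u :: real
    have *: "(a * u)\<^sup>2 + a\<^sup>2 = a\<^sup>2 * (1 + u\<^sup>2)" by (simp add: field_simps)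
    have pos: "1 + u\<^sup>2 \<noteq> 0" using zero_le_power2[of u] by linarith
    show "a * (indicator {0<..} (0 + a * u) *\<^sub>R
           ((0 + a * u) ^ 1 * exp (-(0 + a * u)) / ((0 + a * u)\<^sup>2 + a\<^sup>2))) =
           indicat_real {0<..} u *\<^sub>R (exp (-(u * a)) * u / (1 + u\<^sup>2))"
      using a pos unfolding add_0_left *
      by (auto simp: indicator_def zero_less_mult_iff power2_eq_square mult_ac)
  qed
  finally show ?thesis .
qed

section \<open>A Mellin inversion integral\<close>

lemma norm_sin_ge_cosh:
  fixes z :: complex
  shows "norm (sin z) \<ge> \<bar>sin (Re z)\<bar> * ((exp (Im z) + exp (- Im z)) / 2)"
proof -
  have "\<bar>sin (Re z)\<bar> * ((exp (Im z) + exp (- Im z)) / 2) = \<bar>Re (sin z)\<bar>"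
    by (simp add: Re_sin abs_mult)
  also have "\<dots> \<le> norm (sin z)" by (rule abs_Re_le_cmod)
  finally show ?thesis .
qed

lemma norm_sin_ge_Im:
  fixes z :: complex
  shows "norm (sin z) \<ge> \<bar>Im z\<bar> / 2"
proof -
  define y where "y = Im z"
  have "\<bar>y\<bar> \<le> \<bar>exp (- y) - exp y\<bar>"
  proof (cases "y \<ge> 0")
    case True
    hence "exp (- y) \<le> 1" "1 + y \<le> exp y" by (auto intro: exp_ge_add_one_self)
    thus ?thesis using True by linarith
  next
    case False
    hence "exp y \<le> 1" "1 + (-y) \<le> exp (-y)" using exp_ge_add_one_self[of "-y"] by auto
    thus ?thesis using False by linarith
  qed
  also have "\<dots> = \<bar>norm (exp (\<i> * z)) - norm (exp (- (\<i> * z)))\<bar>"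
    by (simp add: y_def)
  also have "\<dots> \<le> norm (exp (\<i> * z) - exp (- (\<i> * z)))"
    by (rule norm_triangle_ineq3)
  also have "\<dots> = 2 * norm (sin z)"
    by (simp add: sin_exp_eq norm_divide norm_mult)
  finally show ?thesis by (simp add: y_def)
qed

lemma integrable_inverse_one_plus_square: "integrable lborel (\<lambda>y::real. 1 / (1 + y\<^sup>2))"
  using integrable_inverse_1_plus_square by (simp add: set_integrable_def inverse_eq_divide)

text \<open>
  The modulus of the sine is at least \<open>\<bar>sin (\<pi> c)\<bar> cosh (\<pi> y)\<close>, and \<open>2 cosh (\<pi> y) \<ge> 1 + y\<^sup>2\<close>. The other factors of the
  integrands below are bounded on the line, so this makes them integrable.
\<close>
lemma vertical_line_sin_bound:
  assumes "sin (pi * c) \<noteq> 0"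
  shows "1 / norm (sin (of_real pi * Complex c y)) \<le> 2 / \<bar>sin (pi * c)\<bar> * (1 / (1 + y\<^sup>2))"
proof -
  define u where "u = pi * \<bar>y\<bar>"
  have "u \<ge> 0" by (simp add: u_def)
  have "1 + y\<^sup>2 \<le> 1 + u + u\<^sup>2 / 2"
  proof -
    have "2 * 1 \<le> pi * pi" using pi_ge_two by (intro mult_mono) auto
    hence "2 * y\<^sup>2 \<le> pi\<^sup>2 * y\<^sup>2" by (intro mult_right_mono) (auto simp: power2_eq_square)
    hence "y\<^sup>2 \<le> u\<^sup>2 / 2" by (simp add: u_def power_mult_distrib)
    thus ?thesis using \<open>u \<ge> 0\<close> by linarith
  qed
  also have "\<dots> \<le> exp u"
    using exp_lower_Taylor_quadratic[OF \<open>u \<ge> 0\<close>] by simp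
  also have "\<dots> \<le> exp (pi * y) + exp (- (pi * y))"
    by (cases "y \<ge> 0") (auto simp: u_def)
  finally have "\<bar>sin (pi * c)\<bar> * ((1 + y\<^sup>2) / 2) \<le> \<bar>sin (pi * c)\<bar> * ((exp (pi * y) + exp (- (pi * y))) / 2)"
    by (intro mult_left_mono divide_right_mono) auto
  also have "\<dots> \<le> norm (sin (of_real pi * Complex c y))"
    using norm_sin_ge_cosh[of "of_real pi * Complex c y"] by simp
  finally have "\<bar>sin (pi * c)\<bar> * ((1 + y\<^sup>2) / 2) \<le> norm (sin (of_real pi * Complex c y))" .
  moreover have "\<bar>sin (pi * c)\<bar> * ((1 + y\<^sup>2) / 2) > 0"
    using assms by (intro mult_pos_pos divide_pos_pos add_pos_nonneg) auto
  ultimately have "1 / norm (sin (of_real pi * Complex c y)) \<le> 1 / (\<bar>sin (pi * c)\<bar> * ((1 + y\<^sup>2) / 2))"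
    by - (rule frac_le[OF zero_le_one order_refl])
  also have "\<dots> = 2 / \<bar>sin (pi * c)\<bar> * (1 / (1 + y\<^sup>2))"
    by simp
  finally show ?thesis .
qed

lemma borel_measurable_Complex [measurable]: "Complex c \<in> borel_measurable borel"
  unfolding Complex_eq[abs_def] by measurable

lemma integrable_vertical_sin:
  assumes "sin (pi * c) \<noteq> 0"
  shows "integrable lborel (\<lambda>y. 1 / norm (sin (of_real pi * Complex c y)))"
proof (rule Bochner_Integration.integrable_bound)
  show "integrable lborel (\<lambda>y::real. 2 / \<bar>sin (pi * c)\<bar> * (1 / (1 + y\<^sup>2)))"
    by (intro integrable_mult_right integrable_inverse_one_plus_square)
  show "AE y in lborel. norm (1 / norm (sin (of_real pi * Complex c y))) \<le> norm (2 / \<bar>sin (pi * c)\<bar> * (1 / (1 + y\<^sup>2)))"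
  proof (intro AE_I2)
    fix y :: real
    have "norm (1 / norm (sin (of_real pi * Complex c y))) = 1 / norm (sin (of_real pi * Complex c y))"
      by simp
    also have "\<dots> \<le> 2 / \<bar>sin (pi * c)\<bar> * (1 / (1 + y\<^sup>2))"
      by (rule vertical_line_sin_bound[OF assms])
    also have "\<dots> \<le> norm (2 / \<bar>sin (pi * c)\<bar> * (1 / (1 + y\<^sup>2)))"
      unfolding real_norm_def by (rule abs_ge_self)
    finally show "norm (1 / norm (sin (of_real pi * Complex c y))) \<le> norm (2 / \<bar>sin (pi * c)\<bar> * (1 / (1 + y\<^sup>2)))" .
  qed
qed measurable

lemma integrable_exp_over_sin:
  assumes "sin (pi * c) \<noteq> 0"
  shows "integrable lborel (\<lambda>y. exp (of_real w * Complex c y) / sin (of_real pi * Complex c y))"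
proof (rule Bochner_Integration.integrable_bound)
  show "integrable lborel (\<lambda>y. exp (w * c) * (1 / norm (sin (of_real pi * Complex c y))))"
    by (intro integrable_mult_right integrable_vertical_sin assms)
qed (auto simp: norm_divide)

lemma contour_integral_rectpath:
  assumes ab: "a < b" "0 < T"
    and cont: "continuous_on (path_image (rectpath (Complex a (-T)) (Complex b T))) f"
  shows "contour_integral (rectpath (Complex a (-T)) (Complex b T)) f =
           contour_integral (linepath (Complex a (-T)) (Complex b (-T))) f
         + \<i> * integral {-T..T} (\<lambda>y. f (Complex b y))
         - contour_integral (linepath (Complex a T) (Complex b T)) f
         - \<i> * integral {-T..T} (\<lambda>y. f (Complex a y))"
proof -
  define a1 a2 a3 a4 where "a1 = Complex a (-T)" and "a2 = Complex b (-T)" and "a3 = Complex b T"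
    and "a4 = Complex a T"
  have rect: "rectpath a1 a3 = linepath a1 a2 +++ linepath a2 a3 +++ linepath a3 a4 +++ linepath a4 a1"
    by (simp add: rectpath_def Let_def a1_def a2_def a3_def a4_def)
  have image: "path_image (rectpath a1 a3) = closed_segment a1 a2 \<union> closed_segment a2 a3 \<union>
           closed_segment a3 a4 \<union> closed_segment a4 a1"
    unfolding rect by (simp add: path_image_join Un_assoc)
  have "continuous_on (closed_segment a1 a2 \<union> closed_segment a2 a3 \<union>
           closed_segment a3 a4 \<union> closed_segment a4 a1) f"
    using cont unfolding image[symmetric] by (simp add: a1_def a3_def)
  hence int: "f contour_integrable_on linepath a1 a2" "f contour_integrable_on linepath a2 a3"
    "f contour_integrable_on linepath a3 a4" "f contour_integrable_on linepath a4 a1"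
    "f contour_integrable_on linepath a4 a3" "f contour_integrable_on linepath a1 a4"
    by (auto intro!: contour_integrable_continuous_linepath simp: closed_segment_commute
             elim: continuous_on_subset)
  have "contour_integral (rectpath a1 a3) f = contour_integral (linepath a1 a2) f +
          (contour_integral (linepath a2 a3) f + (contour_integral (linepath a3 a4) f +
           contour_integral (linepath a4 a1) f))"
    unfolding rect using int
    by (simp add: contour_integral_join contour_integrable_join)
  also have "contour_integral (linepath a3 a4) f = - contour_integral (linepath a4 a3) f"
    using contour_integral_reversepath[of "linepath a3 a4" f] by simp
  also have "contour_integral (linepath a4 a1) f = - contour_integral (linepath a1 a4) f"
    using contour_integral_reversepath[of "linepath a4 a1" f] by simp
  also have "contour_integral (linepath a1 a4) f = \<i> * integral {-T..T} (\<lambda>y. f (Complex a y))"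
    using ab by (intro contour_integral_linepath_same_Re) (auto simp: a1_def a4_def)
  also have "contour_integral (linepath a2 a3) f = \<i> * integral {-T..T} (\<lambda>y. f (Complex b y))"
    using ab by (intro contour_integral_linepath_same_Re) (auto simp: a2_def a3_def)
  finally show ?thesis by (simp add: a1_def a2_def a3_def a4_def)
qed

lemma tendsto_integral_symmetric_interval:
  fixes f :: "real \<Rightarrow> complex"
  assumes "integrable lborel f"
  shows "(\<lambda>n. integral {-real n..real n} f) \<longlonglongrightarrow> integral\<^sup>L lborel f"
proof -
  have [measurable]: "f \<in> borel_measurable lborel" using assms by auto
  have "(\<lambda>n. LBINT y. indicator {-real n..real n} y *\<^sub>R f y) \<longlonglongrightarrow> integral\<^sup>L lborel f"
  proof (rule integral_dominated_convergence[where w = "\<lambda>y. norm (f y)"])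
    show "AE y in lborel. (\<lambda>n. indicator {-real n..real n} y *\<^sub>R f y) \<longlonglongrightarrow> f y"
    proof (intro AE_I2)
      fix y :: real
      obtain N where N: "\<bar>y\<bar> \<le> real N" using real_arch_simple by blast
      have "\<forall>\<^sub>F n in sequentially. indicator {-real n..real n} y *\<^sub>R f y = f y"
        by (rule eventually_mono[OF eventually_ge_at_top[of N]]) (use N in \<open>auto simp: indicator_def\<close>)
      thus "(\<lambda>n. indicator {-real n..real n} y *\<^sub>R f y) \<longlonglongrightarrow> f y"
        by (rule tendsto_eventually)
    qed
  qed (use assms in \<open>auto simp: indicator_def\<close>)
  also have "(\<lambda>n. LBINT y. indicator {-real n..real n} y *\<^sub>R f y) = (\<lambda>n. integral {-real n..real n} f)"
  proof
    fix n
    have "set_integrable lborel {-real n..real n} f"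
      unfolding set_integrable_def using assms by (intro integrable_mult_indicator) auto
    from set_borel_integral_eq_integral(2)[OF this]
    show "(LBINT y. indicator {-real n..real n} y *\<^sub>R f y) = integral {-real n..real n} f"
      by (simp add: set_lebesgue_integral_def)
  qed
  finally show ?thesis .
qed

lemma sin_of_real_pi_eq_0:
  assumes "sin (of_real pi * z) = (0 :: complex)"
  obtains n :: int where "z = of_int n"
proof -
  from assms obtain n :: int where "of_real pi * z = of_real (of_int n * pi)"
    unfolding sin_eq_0 by auto
  hence "of_real pi * z = of_real pi * of_int n" by (simp add: mult.commute)
  thus ?thesis using that by (simp del: mult_cancel_left add: mult_cancel_left)
qed

lemma residue_exp_over_sin:
  fixes w :: real and N :: nat
  shows "residue (\<lambda>t. exp (of_real w * t) / sin (of_real pi * t)) (of_nat N) =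
           (-1) ^ N * exp (of_real w * of_nat N) / of_real pi"
proof -
  have "residue (\<lambda>t. exp (of_real w * t) / sin (of_real pi * t)) (of_nat N) =
          exp (of_real w * of_nat N) / (of_real pi * cos (of_real pi * of_nat N))"
  proof (rule residue_simple_pole_deriv[where s = UNIV])
    show "((\<lambda>t. sin (of_real pi * t)) has_field_derivative of_real pi * cos (of_real pi * of_nat N)) (at (of_nat N))"
      by (auto intro!: derivative_eq_intros)
    have "cos (of_real pi * of_nat N :: complex) = of_real (cos (pi * real N))"
      by (metis cos_of_real of_real_mult of_real_of_nat_eq)
    thus "of_real pi * cos (of_real pi * of_nat N :: complex) \<noteq> 0"
      by (simp add: cos_npi2)
    have "sin (of_real pi * of_nat N :: complex) = of_real (sin (pi * real N))"
      by (metis sin_of_real of_real_mult of_real_of_nat_eq)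
    thus "sin (of_real pi * of_nat N :: complex) = 0" by simp
  qed (auto intro!: holomorphic_intros)
  also have "cos (of_real pi * of_nat N :: complex) = of_real (cos (pi * real N))"
    by (metis cos_of_real of_real_mult of_real_of_nat_eq)
  also have "cos (pi * real N) = (-1) ^ N"
    by (simp add: cos_npi2)
  finally show ?thesis by (cases "even N") auto
qed

text \<open>
  The integrals along \<open>Re t = c\<close> and \<open>Re t = c + 1\<close> differ by the residue at \<open>m + 1\<close>, while the substitution
  \<open>t \<mapsto> t + 1\<close> multiplies the integrand by \<open>- e\<^sup>w\<close>. These two relations determine the integral.
\<close>
lemma vertical_integral_exp_over_sin:
  fixes w c :: real and m :: nat
  assumes c: "real m < c" "c < real m + 1"
  shows "(LBINT y. exp (of_real w * Complex c y) / sin (of_real pi * Complex c y)) =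
           of_real (2 * (-1) ^ m * exp (w * (real m + 1)) / (1 + exp w))"
proof -
  define f :: "complex \<Rightarrow> complex" where "f = (\<lambda>t. exp (of_real w * t) / sin (of_real pi * t))"
  define I where "I = (LBINT y. f (Complex c y))"
  define S where "S = {t. real m < Re t} \<inter> {t. Re t < real m + 2}"
  define z0 :: complex where "z0 = of_nat (m + 1)"
  have sin_nz: "sin (of_real pi * t) \<noteq> 0" if t: "t \<in> S - {z0}" for t
  proof
    assume "sin (of_real pi * t) = 0"
    then obtain n :: int where n: "t = of_int n" by (rule sin_of_real_pi_eq_0)
    from t have "int m < n" "n < int m + 2" by (auto simp: S_def n)
    hence "n = int (m + 1)" by simp
    with t n show False by (simp add: z0_def)
  qed
  have sin_nz_real: "sin (pi * x) \<noteq> 0" if "x = c \<or> x = c + 1" for x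
  proof -
    have "Complex x 0 \<in> S - {z0}"
      using that c by (auto simp: S_def z0_def complex_eq_iff)
    from sin_nz[OF this] have "sin (of_real pi * Complex x 0) \<noteq> 0" .
    moreover have "of_real pi * Complex x 0 = of_real (pi * x)" by (simp add: complex_eq_iff)
    ultimately show ?thesis by (metis sin_of_real of_real_0)
  qed
  have holo: "f holomorphic_on S - {z0}"
    unfolding f_def using sin_nz by (intro holomorphic_intros) auto
  have S: "open S" "convex S"
    unfolding S_def
    by (auto intro!: open_Int convex_Int open_halfspace_Re_gt open_halfspace_Re_lt
          convex_halfspace_Re_gt convex_halfspace_Re_lt)
  define R :: complex where "R = (-1) ^ (m + 1) * exp (of_real w * of_nat (m + 1)) / of_real pi"
  define hor where "hor = (\<lambda>y. contour_integral (linepath (Complex c y) (Complex (c + 1) y)) f)"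
  have rect: "2 * pi * \<i> * R = hor (- real n) + \<i> * integral {-real n..real n} (\<lambda>y. f (Complex (c + 1) y))
         - hor (real n) - \<i> * integral {-real n..real n} (\<lambda>y. f (Complex c y))" if n: "n > 0" for n
  proof -
    define g where "g = rectpath (Complex c (- real n)) (Complex (c + 1) (real n))"
    have "path_image g \<subseteq> cbox (Complex c (- real n)) (Complex (c + 1) (real n))"
      unfolding g_def by (rule path_image_rectpath_subset_cbox) auto
    also have "\<dots> \<subseteq> S"
      using c by (auto simp: S_def in_cbox_complex_iff)
    finally have "path_image g \<subseteq> S" .
    have inside: "z0 \<in> box (Complex c (- real n)) (Complex (c + 1) (real n))"
      using c n by (auto simp: z0_def in_box_complex_iff)
    have "z0 \<notin> path_image g"
      using inside by (simp add: g_def path_image_rectpath_cbox_minus_box)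
    with \<open>path_image g \<subseteq> S\<close> have image: "path_image g \<subseteq> S - {z0}" by auto
    have "contour_integral g f = 2 * pi * \<i> * (\<Sum>p\<in>{z0}. winding_number g p * residue f p)"
    proof (rule Residue_theorem)
      show "\<forall>z. z \<notin> S \<longrightarrow> winding_number g z = 0"
        using S \<open>path_image g \<subseteq> S\<close>
        by (auto intro!: winding_number_zero_outside[where s = S] simp: g_def)
    qed (use S holo image in \<open>auto simp: g_def convex_connected\<close>)
    also have "(\<Sum>p\<in>{z0}. winding_number g p * residue f p) = winding_number g z0 * residue f z0"
      by simp
    also have "winding_number g z0 = 1"
      unfolding g_def by (rule winding_number_rectpath[OF inside])
    also have "residue f z0 = R"
      unfolding f_def z0_def R_def by (rule residue_exp_over_sin)
    finally have "contour_integral g f = 2 * pi * \<i> * R" by simp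
    moreover have "continuous_on (path_image g) f"
      using holo image by (meson holomorphic_on_imp_continuous_on holomorphic_on_subset)
    ultimately show ?thesis
      using contour_integral_rectpath[of c "c + 1" "real n" f] n
      by (simp add: g_def hor_def)
  qed
  have f_shift: "f (Complex (c + 1) y) = - of_real (exp w) * f (Complex c y)" for y
  proof -
    have *: "Complex (c + 1) y = Complex c y + 1" by (simp add: complex_eq_iff)
    show ?thesis
      unfolding f_def * by (simp add: distrib_left exp_add sin_plus_pi exp_of_real)
  qed
  have int: "integrable lborel (\<lambda>y. f (Complex x y))" if "x = c \<or> x = c + 1" for x
    unfolding f_def by (intro integrable_exp_over_sin sin_nz_real that)
  have lim: "(\<lambda>n. integral {-real n..real n} (\<lambda>y. f (Complex x y))) \<longlonglongrightarrow> (LBINT y. f (Complex x y))"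
    if "x = c \<or> x = c + 1" for x
    by (intro tendsto_integral_symmetric_interval int that)
  define K where "K = exp (\<bar>w\<bar> * (c + 1))"
  \<comment> \<open>On the horizontal sides the numerator is bounded and \<open>\<bar>sin (\<pi> t)\<bar>\<close> is at least \<open>\<bar>Im t\<bar>\<close>.\<close>
  have hor_bound: "norm (hor y) \<le> K / \<bar>y\<bar>" if y: "y \<noteq> 0" for y
  proof -
    have seg: "closed_segment (Complex c y) (Complex (c + 1) y) \<subseteq> {t. c \<le> Re t \<and> Re t \<le> c + 1 \<and> Im t = y}"
      by (auto simp: closed_segment_same_Im closed_segment_eq_real_ivl)
    have sub: "closed_segment (Complex c y) (Complex (c + 1) y) \<subseteq> S - {z0}"
      using seg y c by (fastforce simp: S_def z0_def)
    have "norm (hor y) \<le> K / \<bar>y\<bar> * norm (Complex (c + 1) y - Complex c y)"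
      unfolding hor_def
    proof (rule contour_integral_bound_linepath)
      show "f contour_integrable_on linepath (Complex c y) (Complex (c + 1) y)"
        using holo sub by (intro contour_integrable_continuous_linepath)
          (meson holomorphic_on_imp_continuous_on holomorphic_on_subset)
      show "K / \<bar>y\<bar> \<ge> 0" by (simp add: K_def)
      fix t assume "t \<in> closed_segment (Complex c y) (Complex (c + 1) y)"
      hence t: "c \<le> Re t" "Re t \<le> c + 1" "Im t = y" using seg by auto
      have "w * Re t \<le> \<bar>w\<bar> * (c + 1)"
        using t c by (intro mult_mono) auto
      hence 1: "norm (exp (of_real w * t)) \<le> K" by (simp add: K_def)
      have "\<bar>y\<bar> \<le> pi * \<bar>y\<bar> / 2"
        using mult_right_mono[OF pi_ge_two abs_ge_zero[of y]] by simp
      also have "\<dots> \<le> norm (sin (of_real pi * t))"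
        using norm_sin_ge_Im[of "of_real pi * t"] t by (simp add: abs_mult)
      finally have 2: "\<bar>y\<bar> \<le> norm (sin (of_real pi * t))" .
      show "norm (f t) \<le> K / \<bar>y\<bar>"
        unfolding f_def norm_divide using 1 2 y by (intro frac_le) (auto simp: K_def)
    qed
    also have "Complex (c + 1) y - Complex c y = 1" by (simp add: complex_eq_iff)
    finally show ?thesis by simp
  qed
  have hor_lim: "(\<lambda>n. hor (real n)) \<longlonglongrightarrow> 0" "(\<lambda>n. hor (- real n)) \<longlonglongrightarrow> 0"
  proof -
    have K0: "(\<lambda>n. K / real n) \<longlonglongrightarrow> 0" by (rule lim_const_over_n)
    show "(\<lambda>n. hor (real n)) \<longlonglongrightarrow> 0"
    proof (rule Lim_null_comparison[OF _ K0], rule eventually_mono[OF eventually_gt_at_top[of 0]])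
      show "norm (hor (real n)) \<le> K / real n" if "n > 0" for n
        using hor_bound[of "real n"] that by simp
    qed
    show "(\<lambda>n. hor (- real n)) \<longlonglongrightarrow> 0"
    proof (rule Lim_null_comparison[OF _ K0], rule eventually_mono[OF eventually_gt_at_top[of 0]])
      show "norm (hor (- real n)) \<le> K / real n" if "n > 0" for n
        using hor_bound[of "- real n"] that by simp
    qed
  qed
  have lim1: "(\<lambda>n. hor (- real n) + \<i> * integral {-real n..real n} (\<lambda>y. f (Complex (c + 1) y))
         - hor (real n) - \<i> * integral {-real n..real n} (\<lambda>y. f (Complex c y)))
        \<longlonglongrightarrow> 0 + \<i> * (LBINT y. f (Complex (c + 1) y)) - 0 - \<i> * (LBINT y. f (Complex c y))"
    by (intro tendsto_intros hor_lim lim) auto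
  have lim2: "(\<lambda>n. hor (- real n) + \<i> * integral {-real n..real n} (\<lambda>y. f (Complex (c + 1) y))
         - hor (real n) - \<i> * integral {-real n..real n} (\<lambda>y. f (Complex c y))) \<longlonglongrightarrow> 2 * pi * \<i> * R"
    by (rule tendsto_eventually, rule eventually_mono[OF eventually_gt_at_top[of 0]]) (rule rect[symmetric])
  have "2 * pi * \<i> * R = \<i> * (LBINT y. f (Complex (c + 1) y)) - \<i> * (LBINT y. f (Complex c y))"
    using LIMSEQ_unique[OF lim2 lim1] by simp
  also have "(LBINT y. f (Complex (c + 1) y)) = - of_real (exp w) * I"
    unfolding f_shift I_def by (rule integral_mult_right_zero)
  also have "(LBINT y. f (Complex c y)) = I" by (simp add: I_def)
  also have "\<i> * (- of_real (exp w) * I) - \<i> * I = \<i> * (- (1 + of_real (exp w)) * I)"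
    by (simp add: ring_distribs)
  also have "2 * pi * \<i> * R = \<i> * (2 * pi * R)" by simp
  finally have eq: "2 * pi * R = - (1 + of_real (exp w)) * I" by (simp only: mult_cancel_left) simp
  define D :: complex where "D = 1 + of_real (exp w)"
  define E where "E = exp (w * (real m + 1))"
  have "exp (of_real w * of_nat (m + 1)) = exp (complex_of_real (w * (real m + 1)))" by (simp add: add.commute)
  hence expE: "exp (of_real w * of_nat (m + 1)) = complex_of_real E" by (simp only: E_def exp_of_real)
  from eq have "2 * pi * R = - (1 + of_real (exp w)) * I" .
  moreover have "2 * pi * R = - (2 * (-1) ^ m * of_real E)"
    unfolding R_def expE by simp
  ultimately have DI: "D * I = 2 * (-1) ^ m * of_real E"
    by (simp only: D_def mult_minus_left neg_equal_iff_equal)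
  have "1 + exp w \<noteq> 0" using exp_gt_zero[of w] by linarith
  moreover have D: "D = of_real (1 + exp w)" by (simp add: D_def)
  ultimately have "D \<noteq> 0" by (simp only: of_real_eq_0_iff not_False_eq_True)
  hence "I = (D * I) / D" by simp
  also have "\<dots> = (2 * (-1) ^ m * of_real E) / D" by (simp only: DI)
  also have "\<dots> = of_real (2 * (-1) ^ m * exp (w * (real m + 1)) / (1 + exp w))"
    unfolding D E_def by simp
  finally have "I = of_real (2 * (-1) ^ m * exp (w * (real m + 1)) / (1 + exp w))" .
  thus ?thesis by (simp add: I_def f_def)
qed

section \<open>Mellin-Barnes integrals\<close>

lemma Gamma_lborel:
  assumes z: "Re z > 0"
  shows "set_integrable lborel {0<..} (\<lambda>x. complex_of_real x powr (z - 1) / of_real (exp x))"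
    and "(LBINT x:{0<..}. complex_of_real x powr (z - 1) / of_real (exp x)) = Gamma z"
proof -
  let ?f = "\<lambda>x. complex_of_real x powr (z - 1) / of_real (exp x)"
  have [measurable]: "(\<lambda>x. indicator {0<..} x *\<^sub>R ?f x) \<in> borel_measurable borel"
    by (auto intro!: borel_measurable_continuous_on_indicator continuous_intros)
  have "set_integrable lebesgue {0<..} ?f"
    using absolutely_integrable_Gamma_integral'[OF z] by simp
  thus int: "set_integrable lborel {0<..} ?f"
    by (simp add: set_integrable_def integrable_completion)
  show "(LBINT x:{0<..}. ?f x) = Gamma z"
    using set_borel_integral_eq_integral(2)[OF int] Gamma_integral_complex'[OF z]
    by (simp add: integral_unique)
qed

text \<open>
  The modulus of Euler's integrand depends only on \<open>Re z\<close>. Hence, for \<open>s > 0\<close>, this number bounds \<open>\<bar>\<Gamma>(z)\<bar>\<close> on the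
  whole line \<open>Re z = s\<close>.
\<close>
definition gamma_norm_integral :: "real \<Rightarrow> real" where
  "gamma_norm_integral s = (LBINT x:{0<..}. norm (complex_of_real x powr (of_real s - 1) / of_real (exp x)))"

text \<open>
  For \<open>a > 0\<close> the exponential is \<open>a\<^bsup>2 t\<^esup>\<close>, written so that its modulus and its dependence on \<open>t\<close> are plain.
\<close>
definition mellin_kernel :: "nat \<Rightarrow> real \<Rightarrow> complex \<Rightarrow> complex" where
  "mellin_kernel p a t = Gamma (2 * of_nat p - 2 * t) * exp (of_real (2 * ln a) * t) / sin (of_real pi * t)"

context
  fixes m p :: nat and c :: real
  assumes pm: "p > m" and c: "real m < c" "c < real m + 1"
begin

lemma sin_line_nonzero: "sin (pi * c) \<noteq> 0"
proof
  assume "sin (pi * c) = 0"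
  then obtain n :: int where "pi * c = of_int n * pi" by (auto simp: sin_zero_iff_int2)
  hence "c = of_int n" by simp
  with c have "int m < n" "n < int m + 1" by linarith+
  thus False by simp
qed

lemma c_less_p: "c < real p"
  using c pm by linarith

lemma norm_Gamma_line:
  "norm (Gamma (2 * of_nat p - 2 * Complex c y)) \<le> gamma_norm_integral (2 * real p - 2 * c)"
proof -
  define z where "z = 2 * of_nat p - 2 * Complex c y"
  have z: "Re z > 0" using c_less_p by (simp add: z_def)
  have "norm (Gamma z) \<le> (LBINT x. norm (indicator {0<..} x *\<^sub>R (complex_of_real x powr (z - 1) / of_real (exp x))))"
    unfolding Gamma_lborel(2)[OF z, symmetric] set_lebesgue_integral_def by (rule integral_norm_bound)
  also have "\<dots> = gamma_norm_integral (2 * real p - 2 * c)"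
    unfolding gamma_norm_integral_def set_lebesgue_integral_def
    by (intro Bochner_Integration.integral_cong)
       (auto simp: norm_divide norm_powr_real_powr z_def indicator_def)
  finally show ?thesis by (simp add: z_def)
qed

context
  fixes a :: real
  assumes a: "a > 0"
begin

lemma norm_mellin_kernel:
  "norm (mellin_kernel p a (Complex c y)) \<le> gamma_norm_integral (2 * real p - 2 * c) * exp (2 * c * ln a) *
     (1 / norm (sin (of_real pi * Complex c y)))"
proof -
  have "norm (mellin_kernel p a (Complex c y)) = norm (Gamma (2 * of_nat p - 2 * Complex c y)) * (exp (2 * c * ln a) *
     (1 / norm (sin (of_real pi * Complex c y))))"
    by (simp add: mellin_kernel_def norm_mult norm_divide mult_ac)
  also have "\<dots> \<le> gamma_norm_integral (2 * real p - 2 * c) * (exp (2 * c * ln a) *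
     (1 / norm (sin (of_real pi * Complex c y))))"
    by (intro mult_right_mono norm_Gamma_line) auto
  finally show ?thesis by (simp add: mult_ac)
qed

text \<open>
  Euler's integral turns the line integral into a double integral over \<open>x > 0\<close> and \<open>y\<close>. The modulus of its integrand is
  a function of \<open>x\<close> times a function of \<open>y\<close>, both integrable, so the order may be exchanged. For
  fixed \<open>x\<close> the integral over \<open>y\<close> is the elementary one with \<open>e\<^sup>w = (a / x)\<^sup>2\<close>.
\<close>
lemma mellin_kernel_line:
  shows integrable_mellin_kernel: "integrable lborel (\<lambda>y. mellin_kernel p a (Complex c y))"
    and integral_mellin_kernel: "(LBINT y. mellin_kernel p a (Complex c y)) =
           of_real (2 * (-1) ^ m * a ^ (2 * m + 2) * stieltjes (2 * (p - m) - 1) a)"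
proof -
  define H :: "real \<Rightarrow> real \<Rightarrow> complex" where "H = (\<lambda>x y. (indicator {0<..} x * (x ^ (2 * p - 1) * exp (-x))) *\<^sub>R
    (exp (of_real (2 * ln (a / x)) * Complex c y) / sin (of_real pi * Complex c y)))"
  have H_eq: "H x y = exp (of_real (2 * ln a) * Complex c y) / sin (of_real pi * Complex c y) *
                (indicator {0<..} x *\<^sub>R (complex_of_real x powr ((2 * of_nat p - 2 * Complex c y) - 1) / of_real (exp x)))"
    for x y
  proof (cases "x > 0")
    case True
    have "2 * of_nat p - 2 * Complex c y - 1 = of_nat (2 * p - 1) - 2 * Complex c y"
      using pm by (simp add: of_nat_diff)
    hence "complex_of_real x powr (2 * of_nat p - 2 * Complex c y - 1) =
             of_real x powr of_nat (2 * p - 1) / of_real x powr (2 * Complex c y)"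
      by (simp only: powr_diff)
    also have "complex_of_real x powr of_nat (2 * p - 1) = of_real (x ^ (2 * p - 1))"
      using True by (subst powr_nat') auto
    also have "complex_of_real x powr (2 * Complex c y) = exp (2 * Complex c y * of_real (ln x))"
      using True by (simp add: powr_def Ln_of_real)
    finally have "complex_of_real x powr (2 * of_nat p - 2 * Complex c y - 1) =
             of_real (x ^ (2 * p - 1)) * exp (- (2 * Complex c y * of_real (ln x)))"
      by (simp only: exp_minus divide_inverse)
    moreover have "exp (of_real (2 * ln (a / x)) * Complex c y) =
        exp (of_real (2 * ln a) * Complex c y) * exp (- (2 * Complex c y * of_real (ln x)))"
      using True a by (simp add: ln_div algebra_simps flip: exp_add)
    ultimately show ?thesis
      using True by (simp add: H_def scaleR_conv_of_real exp_minus divide_inverse exp_of_real[symmetric])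
  qed (simp add: H_def)
  define z0 where "z0 = complex_of_real (2 * real p - 2 * c)"
  have int_z0: "integrable lborel (\<lambda>x. norm (indicator {0<..} x *\<^sub>R (complex_of_real x powr (z0 - 1) / of_real (exp x))))"
    using Gamma_lborel(1)[of z0] c_less_p unfolding set_integrable_def
    by (intro integrable_norm) (simp_all add: z0_def)
  have H_int: "integrable (lborel \<Otimes>\<^sub>M lborel) (case_prod H)"
  proof (rule integrable_pair_bound[OF _ int_z0 integrable_mult_right[OF integrable_vertical_sin[OF sin_line_nonzero],
            of "exp (2 * c * ln a)"]])
    show "case_prod H \<in> borel_measurable (lborel \<Otimes>\<^sub>M lborel)"
      unfolding H_def by measurable
    fix x y :: real
    have "norm (case_prod H (x, y)) = 
            norm (indicator {0<..} x *\<^sub>R (complex_of_real x powr (z0 - 1) / of_real (exp x))) *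
            (exp (2 * c * ln a) * (1 / norm (sin (of_real pi * Complex c y))))"
      unfolding case_prod_conv H_eq
      by (cases "x > 0") (simp_all add: norm_mult norm_divide norm_powr_real_powr z0_def mult_ac)
    thus "norm (case_prod H (x, y)) \<le>
            norm (indicator {0<..} x *\<^sub>R (complex_of_real x powr (z0 - 1) / of_real (exp x))) *
            (exp (2 * c * ln a) * (1 / norm (sin (of_real pi * Complex c y))))" by simp
  qed
  have inner_x: "(LBINT x. H x y) = mellin_kernel p a (Complex c y)" for y
  proof -
    have "Re (2 * of_nat p - 2 * Complex c y) > 0" using c_less_p by simp
    from Gamma_lborel(2)[OF this, unfolded set_lebesgue_integral_def] show ?thesis
      unfolding H_eq integral_mult_right_zero mellin_kernel_def by (simp add: mult.commute)
  qed
  have inner_y: "(LBINT y. H x y) = of_real (2 * (-1) ^ m * a ^ (2 * m + 2) *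
      (indicator {0<..} x *\<^sub>R (x ^ (2 * (p - m) - 1) * exp (-x) / (x\<^sup>2 + a\<^sup>2))))" for x
  proof (cases "x > 0")
    case True
    define w where "w = 2 * ln (a / x)"
    have ew: "exp w = (a / x)\<^sup>2"
      using True a by (simp add: w_def exp_double)
    have "exp (w * (real m + 1)) = exp w ^ Suc m"
      using exp_of_nat_mult[of "Suc m" w] by (simp add: mult.commute add.commute del: power_Suc)
    hence ewm: "exp (w * (real m + 1)) = (a / x) ^ (2 * m + 2)"
      unfolding ew by (simp add: power_mult[symmetric] flip: power_Suc)
    have xx: "x ^ (2 * p - 1) = x ^ (2 * (p - m) - 1) * x ^ (2 * m)"
    proof -
      have "2 * p - 1 = (2 * (p - m) - 1) + 2 * m" using pm by simp
      thus ?thesis by (simp only: power_add)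
    qed
    have "(LBINT y. H x y) = (x ^ (2 * p - 1) * exp (-x)) *\<^sub>R
             of_real (2 * (-1) ^ m * exp (w * (real m + 1)) / (1 + exp w))"
      unfolding H_def w_def vertical_integral_exp_over_sin[OF c, symmetric] using True by simp
    also have "\<dots> = of_real (2 * (-1) ^ m * ((x ^ (2 * p - 1) * exp (-x)) * ((a / x) ^ (2 * m + 2) / (1 + (a / x)\<^sup>2))))"
      unfolding ew ewm by (simp add: scaleR_conv_of_real)
    also have "(a / x) ^ (2 * m + 2) / (1 + (a / x)\<^sup>2) = a ^ (2 * m + 2) / (x ^ (2 * m) * (x\<^sup>2 + a\<^sup>2))"
    proof -
      have "1 + (a / x)\<^sup>2 = (x\<^sup>2 + a\<^sup>2) / x\<^sup>2" using True by (simp add: field_simps)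
      thus ?thesis using True by (simp add: power_divide power_add power2_eq_square)
    qed
    also have "x ^ (2 * p - 1) * exp (-x) * (a ^ (2 * m + 2) / (x ^ (2 * m) * (x\<^sup>2 + a\<^sup>2))) =
                 a ^ (2 * m + 2) * (x ^ (2 * (p - m) - 1) * exp (-x) / (x\<^sup>2 + a\<^sup>2))"
      unfolding xx using True by simp
    finally show ?thesis using True by (simp add: mult.assoc)
  qed (simp add: H_def)
  show "integrable lborel (\<lambda>y. mellin_kernel p a (Complex c y))"
    using lborel_pair.integrable_snd[OF H_int] by (simp add: inner_x)
  have "(LBINT y. mellin_kernel p a (Complex c y)) = (LBINT x. (LBINT y. H x y))"
    using lborel_pair.Fubini_integral[OF H_int] by (simp add: inner_x)
  also have "\<dots> = of_real (2 * (-1) ^ m * a ^ (2 * m + 2) * stieltjes (2 * (p - m) - 1) a)"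
    unfolding inner_y stieltjes_def set_lebesgue_integral_def integral_complex_of_real
      integral_mult_right_zero ..
  finally show "(LBINT y. mellin_kernel p a (Complex c y)) =
           of_real (2 * (-1) ^ m * a ^ (2 * m + 2) * stieltjes (2 * (p - m) - 1) a)" .
qed

end

end

section \<open>Evaluation of the series over the frequencies\<close>

text \<open>
  Both auxiliary integrals of \<open>Si\<close> occur in \<open>Si_laplace\<close>; at a zero of the cosine only the one with the sine survives, and
  the substitution \<open>x = a u\<close> identifies it with \<open>S\<^sub>1(a)\<close>.
\<close>
lemma stieltjes_freq:
  "(-1) ^ k * stieltjes 1 (freq k) = pi / 2 - Si (freq k)"
proof -
  have "pi / 2 - Si (freq k) = (LBINT u:{0<..}. (-1) ^ k * (exp (-(u * freq k)) * u / (1 + u\<^sup>2)))"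
    unfolding Si_laplace[OF freq_pos] by (simp add: mult_ac)
  also have "\<dots> = (-1) ^ k * stieltjes 1 (freq k)"
    unfolding stieltjes_1_scale[OF freq_pos] by (rule set_integral_mult_right)
  finally show ?thesis ..
qed

definition inverse_freq_sum :: "nat \<Rightarrow> real" where
  "inverse_freq_sum n = (\<Sum>k. 1 / freq k ^ n)"

lemma sums_inverse_freq_sum: "n \<ge> 2 \<Longrightarrow> (\<lambda>k. 1 / freq k ^ n) sums inverse_freq_sum n"
  unfolding inverse_freq_sum_def by (intro summable_sums summable_inverse_freq_power)

text \<open>
  Induction on \<open>d = p - m - 1\<close>. The sign and the exponent are chosen such that, by \<open>stieltjes_rec\<close>, passing from \<open>d\<close> to
  \<open>d + 1\<close> only adds a multiple of the series in \<open>sums_sech_coeff\<close>.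
\<close>
lemma sums_stieltjes_freq:
  assumes m: "m \<ge> 1"
  shows "(\<lambda>k. - 2 * (-1) ^ (m + Suc d) * (-1) ^ k * stieltjes (2 * d + 1) (freq k) / freq k ^ (2 * (m + Suc d) - 1)) sums
           ((-1) ^ m * pi * inverse_freq_sum (2 * m + 1)
            + (\<Sum>j\<le>m. sech_coeff j * harm (2 * m - 2 * j) / fact (2 * m - 2 * j))
            + (\<Sum>j<d. fact (2 * j + 1) * sech_coeff (m + Suc j)))"
proof (induction d)
  case 0
  let ?Y = "\<Sum>j\<le>m. sech_coeff j * harm (2 * m - 2 * j) / fact (2 * m - 2 * j)"
  have "(\<lambda>k. (-1) ^ m * pi * (1 / freq k ^ (2 * m + 1)) - (-1) ^ m * (2 * Si (freq k) / freq k ^ (2 * m + 1))) sums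
          ((-1) ^ m * pi * inverse_freq_sum (2 * m + 1) - (-1) ^ m * ((-1) ^ (m + 1) * ?Y))"
    using m by (intro sums_diff sums_mult sums_inverse_freq_sum sums_Si_freq) auto
  also have "(-1) ^ m * ((-1) ^ (m + 1) * ?Y) = - ?Y"
    by (simp add: mult.assoc[symmetric] flip: power_add)
  also have "(\<lambda>k. (-1) ^ m * pi * (1 / freq k ^ (2 * m + 1)) - (-1) ^ m * (2 * Si (freq k) / freq k ^ (2 * m + 1))) =
             (\<lambda>k. - 2 * (-1) ^ (m + Suc 0) * (-1) ^ k * stieltjes (2 * 0 + 1) (freq k) / freq k ^ (2 * (m + Suc 0) - 1))"
  proof
    fix k
    have "- 2 * (-1) ^ (m + Suc 0) * (-1) ^ k * stieltjes (2 * 0 + 1) (freq k) / freq k ^ (2 * (m + Suc 0) - 1) =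
          2 * (-1) ^ m * ((-1) ^ k * stieltjes 1 (freq k)) / freq k ^ (2 * m + 1)"
      by simp
    also have "\<dots> = (-1) ^ m * pi * (1 / freq k ^ (2 * m + 1)) - (-1) ^ m * (2 * Si (freq k) / freq k ^ (2 * m + 1))"
      unfolding stieltjes_freq by (simp add: diff_divide_distrib right_diff_distrib)
    finally show "(-1) ^ m * pi * (1 / freq k ^ (2 * m + 1)) - (-1) ^ m * (2 * Si (freq k) / freq k ^ (2 * m + 1)) =
      - 2 * (-1) ^ (m + Suc 0) * (-1) ^ k * stieltjes (2 * 0 + 1) (freq k) / freq k ^ (2 * (m + Suc 0) - 1)" ..
  qed
  finally show ?case by simp
next
  case (Suc d)
  define p where "p = m + Suc d"
  have p: "m + Suc (Suc d) = Suc p" by (simp add: p_def)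
  have "(\<lambda>k. fact (2 * d + 1) * ((-1) ^ p * (2 * (-1) ^ k / freq k ^ (2 * p + 1)))) sums
          (fact (2 * d + 1) * ((-1) ^ p * ((-1) ^ p * sech_coeff p)))"
    by (intro sums_mult sums_sech_coeff)
  also have "(-1) ^ p * ((-1) ^ p * sech_coeff p) = sech_coeff p"
    by (simp add: mult.assoc[symmetric] flip: power_add)
  finally have "(\<lambda>k. - 2 * (-1) ^ p * (-1) ^ k * stieltjes (2 * d + 1) (freq k) / freq k ^ (2 * p - 1)
                 + fact (2 * d + 1) * ((-1) ^ p * (2 * (-1) ^ k / freq k ^ (2 * p + 1)))) sums
          (((-1) ^ m * pi * inverse_freq_sum (2 * m + 1)
            + (\<Sum>j\<le>m. sech_coeff j * harm (2 * m - 2 * j) / fact (2 * m - 2 * j))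
            + (\<Sum>j<d. fact (2 * j + 1) * sech_coeff (m + Suc j))) + fact (2 * d + 1) * sech_coeff p)"
    by (rule sums_add[OF Suc.IH[folded p_def]])
  also have "(\<lambda>k. - 2 * (-1) ^ p * (-1) ^ k * stieltjes (2 * d + 1) (freq k) / freq k ^ (2 * p - 1)
                 + fact (2 * d + 1) * ((-1) ^ p * (2 * (-1) ^ k / freq k ^ (2 * p + 1)))) =
             (\<lambda>k. - 2 * (-1) ^ Suc p * (-1) ^ k * stieltjes (2 * Suc d + 1) (freq k) / freq k ^ (2 * Suc p - 1))"
  proof
    fix k
    have eq: "2 * Suc d + 1 = (2 * d + 1) + 2" "2 * Suc p - 1 = 2 * p + 1" by simp_all
    have "2 * p + 1 = (2 * p - 1) + 2" by (simp add: p_def)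
    hence pow: "freq k ^ (2 * p + 1) = freq k ^ (2 * p - 1) * (freq k)\<^sup>2" by (metis power_add)
    show "- 2 * (-1) ^ p * (-1) ^ k * stieltjes (2 * d + 1) (freq k) / freq k ^ (2 * p - 1)
                 + fact (2 * d + 1) * ((-1) ^ p * (2 * (-1) ^ k / freq k ^ (2 * p + 1))) =
          - 2 * (-1) ^ Suc p * (-1) ^ k * stieltjes (2 * Suc d + 1) (freq k) / freq k ^ (2 * Suc p - 1)"
      unfolding eq stieltjes_rec[OF freq_pos] pow by (simp add: field_simps)
  qed
  finally show ?case unfolding p sum.lessThan_Suc by (simp only: add.assoc p_def)
qed

text \<open>
  The terms \<open>1 / (k + 1/2)\<^sup>N = 2\<^sup>N / (2 k + 1)\<^sup>N\<close> are the odd part of the zeta series, and its even part is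
  \<open>2\<^bsup>- N\<^esup>\<close> times the whole.
\<close>
lemma inverse_freq_sum_zeta:
  assumes "N \<ge> 2"
  shows "complex_of_real (pi ^ N * inverse_freq_sum N) = (2 ^ N - 1) * riemann_zeta (of_nat N)"
proof -
  define f where "f = (\<lambda>n. 1 / real (Suc n) ^ N)"
  have "summable (\<lambda>k. 1 / real k ^ N)"
    using inverse_power_summable[of N, where 'a = real] assms by (simp add: inverse_eq_divide)
  hence "summable f" unfolding f_def by (subst summable_Suc_iff)
  then obtain Z where Z: "f sums Z" by (auto simp: summable_def)
  have "riemann_zeta (of_nat N) = (\<Sum>n. complex_of_real (f n))"
    unfolding riemann_zeta_def f_def
    by (intro suminf_cong) (simp add: powr_nat' del: of_nat_Suc)
  also have "\<dots> = of_real Z"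
    using Z by (intro sums_unique[symmetric] sums_of_real)
  finally have zeta: "riemann_zeta (of_nat N) = of_real Z" .
  have "(\<lambda>n. sum f {n * 2..<n * 2 + 2}) sums Z"
    by (rule sums_group[OF Z]) simp
  moreover have "sum f {n * 2..<n * 2 + 2} = f (2 * n) + f (2 * n + 1)" for n
    by (simp add: numeral_2_eq_2 mult.commute)
  ultimately have "(\<lambda>n. f (2 * n) + f (2 * n + 1)) sums Z" by simp
  from sums_mult[OF sums_diff[OF this sums_mult[OF Z, of "1 / 2 ^ N"]], of "2 ^ N"]
  have "(\<lambda>n. 2 ^ N * (f (2 * n) + f (2 * n + 1) - 1 / 2 ^ N * f n)) sums (2 ^ N * (Z - 1 / 2 ^ N * Z))" .
  also have "(\<lambda>n. 2 ^ N * (f (2 * n) + f (2 * n + 1) - 1 / 2 ^ N * f n)) = (\<lambda>n. pi ^ N * (1 / freq n ^ N))"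
  proof
    fix n
    have "f (2 * n + 1) = 1 / (2 * real (Suc n)) ^ N" by (simp add: f_def)
    also have "\<dots> = 1 / 2 ^ N * f n" by (simp add: f_def power_mult_distrib del: of_nat_Suc)
    finally have "2 ^ N * (f (2 * n) + f (2 * n + 1) - 1 / 2 ^ N * f n) = 2 ^ N / real (Suc (2 * n)) ^ N"
      by (simp add: f_def)
    also have "real (Suc (2 * n)) = 2 * (real n + 1 / 2)" by simp
    also have "2 ^ N / \<dots> ^ N = 1 / (real n + 1 / 2) ^ N" by (simp only: power_mult_distrib) simp
    also have "\<dots> = pi ^ N * (1 / freq n ^ N)" by (simp add: freq_def power_mult_distrib)
    finally show "2 ^ N * (f (2 * n) + f (2 * n + 1) - 1 / 2 ^ N * f n) = pi ^ N * (1 / freq n ^ N)" .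
  qed
  finally have "(\<lambda>n. pi ^ N * (1 / freq n ^ N)) sums (2 ^ N * (Z - 1 / 2 ^ N * Z))" .
  from sums_unique2[OF this sums_mult[OF sums_inverse_freq_sum[OF assms]]]
  have "pi ^ N * inverse_freq_sum N = (2 ^ N - 1) * Z" by (simp add: algebra_simps)
  thus ?thesis by (simp add: zeta)
qed

text \<open>
  From \<open>\<psi>(n + 1) = H\<^sub>n - \<gamma>\<close>; the terms with \<open>\<gamma>\<close> add up to zero by \<open>sech_coeff_recurrence\<close>.
\<close>
lemma digamma_sum:
  assumes m: "m \<ge> 1"
  shows "(\<Sum>j\<le>m. euler_number (2 * j) * Digamma (1 - 2 * real j + 2 * real m) /
                         (Gamma (1 - 2 * real j + 2 * real m) * Gamma (2 * real j + 1))) =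
         (\<Sum>j\<le>m. sech_coeff j * harm (2 * m - 2 * j) / fact (2 * m - 2 * j))"
proof -
  have "(\<Sum>j\<le>m. euler_number (2 * j) * Digamma (1 - 2 * real j + 2 * real m) /
                         (Gamma (1 - 2 * real j + 2 * real m) * Gamma (2 * real j + 1))) =
        (\<Sum>j\<le>m. sech_coeff j * harm (2 * m - 2 * j) / fact (2 * m - 2 * j)
                 - euler_mascheroni * (sech_coeff j / fact (2 * m - 2 * j)))"
  proof (intro sum.cong refl)
    fix j assume "j \<in> {..m}"
    hence *: "1 - 2 * real j + 2 * real m = real (Suc (2 * m - 2 * j))" by (simp add: of_nat_diff)
    have **: "2 * real j + 1 = 1 + real (2 * j)" by simp
    have D: "Digamma (real (Suc (2 * m - 2 * j))) = harm (2 * m - 2 * j) - euler_mascheroni"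
      by (rule Digamma_of_nat)
    have G: "Gamma (real (Suc (2 * m - 2 * j))) = fact (2 * m - 2 * j)"
      using Gamma_fact[of "2 * m - 2 * j", where 'a = real] by (simp only: of_nat_Suc)
    have G2: "Gamma (1 + real (2 * j)) = fact (2 * j)" by (rule Gamma_fact)
    show "euler_number (2 * j) * Digamma (1 - 2 * real j + 2 * real m) /
            (Gamma (1 - 2 * real j + 2 * real m) * Gamma (2 * real j + 1)) =
          sech_coeff j * harm (2 * m - 2 * j) / fact (2 * m - 2 * j)
                 - euler_mascheroni * (sech_coeff j / fact (2 * m - 2 * j))"
      unfolding * ** D G G2 sech_coeff_def by (simp add: field_simps)
  qed
  also have "\<dots> = (\<Sum>j\<le>m. sech_coeff j * harm (2 * m - 2 * j) / fact (2 * m - 2 * j))"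
    unfolding sum_subtractf sum_distrib_left[symmetric] sech_coeff_recurrence[OF m] by simp
  finally show ?thesis .
qed

lemma gamma_sum:
  "(\<Sum>j<d. Gamma (2 * real j + 2) * euler_number (2 * j + 2 + 2 * m) / Gamma (2 * real j + 3 + 2 * real m)) =
   (\<Sum>j<d. fact (2 * j + 1) * sech_coeff (m + Suc j))"
proof (intro sum.cong refl)
  fix j
  have eq: "2 * real j + 2 = 1 + real (2 * j + 1)" "2 * real j + 3 + 2 * real m = 1 + real (2 * (m + Suc j))"
    "2 * j + 2 + 2 * m = 2 * (m + Suc j)"
    by simp_all
  show "Gamma (2 * real j + 2) * euler_number (2 * j + 2 + 2 * m) / Gamma (2 * real j + 3 + 2 * real m) =
          fact (2 * j + 1) * sech_coeff (m + Suc j)"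
    unfolding eq Gamma_fact sech_coeff_def by simp
qed

section \<open>The contour integral\<close>

lemma freq_ge_1: "freq k \<ge> 1"
  using freq_ge[of k] by simp

text \<open>
  Since \<open>\<pi> (k + 1/2) = a\<^sub>k\<close>, the power of \<open>\<pi>\<close> and the power of \<open>k + 1/2\<close> combine to \<open>a\<^sub>k\<^bsup>2 t\<^esup>\<close>, up to a factor that is
  constant in \<open>t\<close>.
\<close>
lemma line_term_eq:
  fixes t :: complex
  shows "Gamma (2 * of_nat p - 2 * t) * of_real pi powr (2 * t) / sin (of_real pi * t) *
           ((-1) ^ k * (of_nat k + 1/2) powr (2 * t - 2 * of_nat p - 2 * of_nat m - 1)) =
         of_real ((-1) ^ k * pi ^ (2 * p + 2 * m + 1) / freq k ^ (2 * p + 2 * m + 1)) *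
           mellin_kernel p (freq k) t"
proof -
  define N where "N = 2 * p + 2 * m + 1"
  define b where "b = real k + 1 / 2"
  have b: "b > 0" by (simp add: b_def add_nonneg_pos)
  have freq: "freq k = pi * b" by (simp add: freq_def b_def)
  have e: "2 * t - 2 * of_nat p - 2 * of_nat m - 1 = 2 * t - of_nat N" by (simp add: N_def)
  have cb: "of_nat k + 1 / 2 = complex_of_real b" by (simp add: b_def)
  have "(of_nat k + 1/2) powr (2 * t - 2 * of_nat p - 2 * of_nat m - 1) =
          complex_of_real b powr (2 * t) / complex_of_real b powr of_nat N"
    unfolding e cb by (rule powr_diff)
  also have "complex_of_real b powr of_nat N = of_real (b ^ N)"
    using b by (subst powr_nat') auto
  also have "of_real (b ^ N) = complex_of_real (freq k ^ N / pi ^ N)"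
    unfolding freq by (simp add: power_mult_distrib)
  finally have A: "(of_nat k + 1/2) powr (2 * t - 2 * of_nat p - 2 * of_nat m - 1) =
          complex_of_real b powr (2 * t) * of_real (pi ^ N / freq k ^ N)"
    by simp
  have B: "complex_of_real pi powr (2 * t) * complex_of_real b powr (2 * t) = exp (of_real (2 * ln (freq k)) * t)"
    unfolding freq using b
    by (simp add: powr_def Ln_of_real ln_mult ring_distribs mult_ac flip: exp_add)
  have "Gamma (2 * of_nat p - 2 * t) * of_real pi powr (2 * t) / sin (of_real pi * t) *
           ((-1) ^ k * (of_nat k + 1/2) powr (2 * t - 2 * of_nat p - 2 * of_nat m - 1)) =
        of_real ((-1) ^ k * (pi ^ N / freq k ^ N)) *
          (Gamma (2 * of_nat p - 2 * t) * (complex_of_real pi powr (2 * t) * complex_of_real b powr (2 * t)) /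
           sin (of_real pi * t))"
    unfolding A by (simp add: mult_ac)
  thus ?thesis unfolding B by (simp add: mellin_kernel_def N_def)
qed

context
  fixes m p :: nat and c :: real
  assumes pm: "p > m" and c: "real m < c" "c < real m + 1" and m: "m \<ge> 1"
begin

lemma exp_ln_freq_le: "exp (2 * c * ln (freq k)) \<le> freq k ^ (2 * m + 2)"
proof -
  have "exp (2 * c * ln (freq k)) \<le> exp (real (2 * m + 2) * ln (freq k))"
    using c freq_ge_1[of k] by (intro exp_mono mult_right_mono) auto
  also have "\<dots> = freq k ^ (2 * m + 2)"
    by (simp only: exp_of_nat_mult) simp
  finally show ?thesis .
qed

lemma freq_power_split: "freq k ^ (2 * p + 2 * m + 1) = freq k ^ (2 * m + 2) * freq k ^ (2 * p - 1)"
proof -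
  have "2 * p + 2 * m + 1 = (2 * m + 2) + (2 * p - 1)" using pm by simp
  thus ?thesis by (simp only: power_add)
qed

lemma summable_freq_p: "summable (\<lambda>k. 1 / freq k ^ (2 * p - 1))"
  using pm m by (intro summable_inverse_freq_power) auto

lemma summable_line:
  fixes t :: complex
  assumes t: "Re t = c"
  shows "summable (\<lambda>k::nat. (-1) ^ k * (of_nat k + 1/2 :: complex) powr (2 * t - 2 * of_nat p - 2 * of_nat m - 1))"
proof (rule summable_comparison_test')
  define N where "N = 2 * p + 2 * m + 1"
  define C where "C = pi ^ N / exp (2 * c * ln pi)"
  show "summable (\<lambda>k. C * (1 / freq k ^ (2 * p - 1)))"
    by (intro summable_mult summable_freq_p)
  fix k :: nat
  define b where "b = real k + 1 / 2"
  have b: "b > 0" by (simp add: b_def add_nonneg_pos)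
  have freq: "freq k = pi * b" by (simp add: freq_def b_def)
  have cb: "of_nat k + 1 / 2 = complex_of_real b" by (simp add: b_def)
  have "norm ((-1) ^ k * (of_nat k + 1/2 :: complex) powr (2 * t - 2 * of_nat p - 2 * of_nat m - 1)) =
          b powr (2 * c - real N)"
    unfolding cb using b t by (simp add: norm_mult norm_power norm_powr_real_powr N_def algebra_simps)
  also have "\<dots> = exp (2 * c * ln b) / b ^ N"
    using b by (simp add: powr_diff powr_realpow) (simp add: powr_def)
  also have "exp (2 * c * ln b) = exp (2 * c * ln (freq k)) / exp (2 * c * ln pi)"
    unfolding freq using b by (simp add: ln_mult ring_distribs flip: exp_diff)
  also have "b ^ N = freq k ^ N / pi ^ N"
    unfolding freq by (simp add: power_mult_distrib)
  also have "exp (2 * c * ln (freq k)) / exp (2 * c * ln pi) / (freq k ^ N / pi ^ N) =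
              C * (exp (2 * c * ln (freq k)) / freq k ^ N)"
    by (simp add: C_def)
  also have "\<dots> \<le> C * (freq k ^ (2 * m + 2) / freq k ^ N)"
    by (intro mult_left_mono divide_right_mono exp_ln_freq_le) (auto simp: C_def less_imp_le)
  also have "freq k ^ (2 * m + 2) / freq k ^ N = 1 / freq k ^ (2 * p - 1)"
    unfolding N_def freq_power_split by simp
  finally show "norm ((-1) ^ k * (of_nat k + 1/2 :: complex) powr (2 * t - 2 * of_nat p - 2 * of_nat m - 1))
          \<le> C * (1 / freq k ^ (2 * p - 1))" .
qed

text \<open>
  On the line, the \<open>k\<close>-th term is bounded by a constant times \<open>a\<^sub>k\<^bsup>1 - 2 p\<^esup> / \<bar>sin (\<pi> t)\<bar>\<close>: this uses \<open>c < m + 1\<close> and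
  \<open>a\<^sub>k \<ge> 1\<close>. Since \<open>p > m \<ge> 1\<close>, the bound is summable in \<open>k\<close> and integrable in \<open>y\<close>, so
  sum and integral may be exchanged.
\<close>
lemma line_integral:
  defines "F \<equiv> (\<lambda>t::complex. Gamma (2 * of_nat p - 2 * t) * of_real pi powr (2 * t) / sin (of_real pi * t) *
             (\<Sum>k. (-1) ^ k * (of_nat k + 1/2) powr (2 * t - 2 * of_nat p - 2 * of_nat m - 1)))"
  shows "integrable lborel (\<lambda>y. F (Complex c y))"
    and "(\<lambda>k. complex_of_real (2 * (-1) ^ m * pi ^ (2 * p + 2 * m + 1) *
           ((-1) ^ k * stieltjes (2 * (p - m) - 1) (freq k) / freq k ^ (2 * p - 1)))) sums
           (LBINT y. F (Complex c y))"
proof -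
  define N where "N = 2 * p + 2 * m + 1"
  define r where "r = (\<lambda>k. (-1) ^ k * pi ^ N / freq k ^ N)"
  define h where "h = (\<lambda>k y. complex_of_real (r k) * mellin_kernel p (freq k) (Complex c y))"
  define K where "K = gamma_norm_integral (2 * real p - 2 * c)"
  define s where "s = (\<lambda>y. 1 / norm (sin (of_real pi * Complex c y)))"
  have K: "K \<ge> 0" unfolding K_def gamma_norm_integral_def set_lebesgue_integral_def
    by (intro integral_nonneg_AE) auto
  have s: "s y \<ge> 0" for y by (simp add: s_def)
  have F_eq: "F (Complex c y) = (\<Sum>k. h k y)" for y
  proof -
    have "(\<Sum>k. h k y) = (\<Sum>k. Gamma (2 * of_nat p - 2 * Complex c y) * of_real pi powr (2 * Complex c y) /
             sin (of_real pi * Complex c y) *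
             ((-1) ^ k * (of_nat k + 1/2) powr (2 * Complex c y - 2 * of_nat p - 2 * of_nat m - 1)))"
      unfolding h_def r_def N_def line_term_eq ..
    also have "\<dots> = F (Complex c y)"
      unfolding F_def by (rule suminf_mult[OF summable_line]) simp
    finally show ?thesis ..
  qed
  have bound: "norm (h k y) \<le> pi ^ N * K * (1 / freq k ^ (2 * p - 1)) * s y" for k y
  proof -
    have "norm (h k y) = pi ^ N / freq k ^ N * norm (mellin_kernel p (freq k) (Complex c y))"
      by (simp add: h_def r_def norm_mult norm_divide norm_power)
    also have "\<dots> \<le> pi ^ N / freq k ^ N * (K * exp (2 * c * ln (freq k)) * s y)"
      unfolding K_def s_def
      by (intro mult_left_mono norm_mellin_kernel[OF pm c freq_pos]) (simp_all add: less_imp_le)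
    also have "\<dots> \<le> pi ^ N / freq k ^ N * (K * freq k ^ (2 * m + 2) * s y)"
      by (intro mult_left_mono mult_right_mono exp_ln_freq_le K s) (simp_all add: less_imp_le)
    also have "\<dots> = pi ^ N * K * (1 / freq k ^ (2 * p - 1)) * s y"
      unfolding N_def freq_power_split by simp
    finally show ?thesis .
  qed
  have int_s: "integrable lborel s"
    unfolding s_def by (rule integrable_vertical_sin[OF sin_line_nonzero[OF pm c]])
  have int_h: "integrable lborel (h k)" for k
    unfolding h_def by (intro integrable_mult_right integrable_mellin_kernel[OF pm c freq_pos])
  have ae: "AE y in lborel. summable (\<lambda>k. norm (h k y))"
  proof (intro AE_I2)
    fix y :: real
    have "summable (\<lambda>k. pi ^ N * K * (1 / freq k ^ (2 * p - 1)) * s y)"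
      by (intro summable_mult summable_mult2 summable_freq_p)
    thus "summable (\<lambda>k. norm (h k y))"
      by (rule summable_comparison_test') (use bound in simp)
  qed
  have summ: "summable (\<lambda>k. LBINT y. norm (h k y))"
  proof (rule summable_comparison_test')
    show "summable (\<lambda>k. pi ^ N * K * (1 / freq k ^ (2 * p - 1)) * (LBINT y. s y))"
      by (intro summable_mult summable_mult2 summable_freq_p)
    fix k :: nat
    have "norm (LBINT y. norm (h k y)) = (LBINT y. norm (h k y))"
      by (simp add: integral_nonneg_AE)
    also have "\<dots> \<le> (LBINT y. pi ^ N * K * (1 / freq k ^ (2 * p - 1)) * s y)"
      by (rule Bochner_Integration.integral_mono[OF integrable_norm[OF int_h]
            integrable_mult_right[OF int_s] bound])
    also have "\<dots> = pi ^ N * K * (1 / freq k ^ (2 * p - 1)) * (LBINT y. s y)"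
      by (rule integral_mult_right_zero)
    finally show "norm (LBINT y. norm (h k y)) \<le> pi ^ N * K * (1 / freq k ^ (2 * p - 1)) * (LBINT y. s y)" .
  qed
  show "integrable lborel (\<lambda>y. F (Complex c y))"
    unfolding F_eq by (rule integrable_suminf[OF int_h ae summ])
  have "(\<lambda>k. LBINT y. h k y) sums (LBINT y. F (Complex c y))"
    unfolding F_eq by (rule sums_integral[OF int_h ae summ])
  also have "(\<lambda>k. LBINT y. h k y) = (\<lambda>k. complex_of_real (2 * (-1) ^ m * pi ^ (2 * p + 2 * m + 1) *
           ((-1) ^ k * stieltjes (2 * (p - m) - 1) (freq k) / freq k ^ (2 * p - 1))))"
  proof
    fix k
    have "(LBINT y. h k y) = complex_of_real (r k * (2 * (-1) ^ m * freq k ^ (2 * m + 2) * stieltjes (2 * (p - m) - 1) (freq k)))"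
      unfolding h_def integral_mult_right_zero integral_mellin_kernel[OF pm c freq_pos] by simp
    also have "r k * (2 * (-1) ^ m * freq k ^ (2 * m + 2) * stieltjes (2 * (p - m) - 1) (freq k)) =
      2 * (-1) ^ m * pi ^ (2 * p + 2 * m + 1) *
           ((-1) ^ k * stieltjes (2 * (p - m) - 1) (freq k) / freq k ^ (2 * p - 1))"
      unfolding r_def N_def freq_power_split by simp
    finally show "(LBINT y. h k y) = complex_of_real (2 * (-1) ^ m * pi ^ (2 * p + 2 * m + 1) *
           ((-1) ^ k * stieltjes (2 * (p - m) - 1) (freq k) / freq k ^ (2 * p - 1)))" .
  qed
  finally show "(\<lambda>k. complex_of_real (2 * (-1) ^ m * pi ^ (2 * p + 2 * m + 1) *
           ((-1) ^ k * stieltjes (2 * (p - m) - 1) (freq k) / freq k ^ (2 * p - 1)))) sums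
           (LBINT y. F (Complex c y))" .
qed

lemma line_integral_value:
  defines "F \<equiv> (\<lambda>t::complex. Gamma (2 * of_nat p - 2 * t) * of_real pi powr (2 * t) / sin (of_real pi * t) *
             (\<Sum>k. (-1) ^ k * (of_nat k + 1/2) powr (2 * t - 2 * of_nat p - 2 * of_nat m - 1)))"
  shows "\<i> * (-1) ^ p / of_real pi ^ (2 * p + 1) * vertical_line_integral c F =
           complex_of_real (pi ^ (2 * m + 1) * inverse_freq_sum (2 * m + 1) + (-1) ^ m * pi ^ (2 * m) *
             ((\<Sum>j\<le>m. sech_coeff j * harm (2 * m - 2 * j) / fact (2 * m - 2 * j))
            + (\<Sum>j<p - 1 - m. fact (2 * j + 1) * sech_coeff (m + Suc j))))"
proof -
  define d where "d = p - 1 - m"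
  have p: "p = m + Suc d" using pm by (simp add: d_def)
  define W where "W = (-1) ^ m * pi * inverse_freq_sum (2 * m + 1)
            + (\<Sum>j\<le>m. sech_coeff j * harm (2 * m - 2 * j) / fact (2 * m - 2 * j))
            + (\<Sum>j<d. fact (2 * j + 1) * sech_coeff (m + Suc j))"
  define L where "L = (LBINT y. F (Complex c y))"
  have idx: "2 * (p - m) - 1 = 2 * d + 1" by (simp add: p)
  have sq: "(-1) ^ p * (-1) ^ p = (1 :: real)" by (simp flip: power_add)
  have "(\<lambda>k. complex_of_real (- ((-1) ^ p * (-1) ^ m * pi ^ (2 * p + 2 * m + 1)) *
          (- 2 * (-1) ^ p * (-1) ^ k * stieltjes (2 * d + 1) (freq k) / freq k ^ (2 * p - 1)))) sums
          complex_of_real (- ((-1) ^ p * (-1) ^ m * pi ^ (2 * p + 2 * m + 1)) * W)"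
    unfolding W_def by (intro sums_of_real sums_mult sums_stieltjes_freq[OF m, of d, folded p])
  also have "(\<lambda>k. complex_of_real (- ((-1) ^ p * (-1) ^ m * pi ^ (2 * p + 2 * m + 1)) *
          (- 2 * (-1) ^ p * (-1) ^ k * stieltjes (2 * d + 1) (freq k) / freq k ^ (2 * p - 1)))) =
          (\<lambda>k. complex_of_real (2 * (-1) ^ m * pi ^ (2 * p + 2 * m + 1) *
           ((-1) ^ k * stieltjes (2 * (p - m) - 1) (freq k) / freq k ^ (2 * p - 1))))"
  proof (intro ext arg_cong[of _ _ complex_of_real])
    fix k
    have "- ((-1) ^ p * (-1) ^ m * pi ^ (2 * p + 2 * m + 1)) *
          (- 2 * (-1) ^ p * (-1) ^ k * stieltjes (2 * d + 1) (freq k) / freq k ^ (2 * p - 1)) =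
          ((-1) ^ p * (-1) ^ p) * (2 * (-1) ^ m * pi ^ (2 * p + 2 * m + 1) *
           ((-1) ^ k * stieltjes (2 * (p - m) - 1) (freq k) / freq k ^ (2 * p - 1)))"
      unfolding idx by (simp only: mult_minus_left mult_minus_right minus_minus minus_divide_left[symmetric] mult_ac
            times_divide_eq_left times_divide_eq_right)
    thus "- ((-1) ^ p * (-1) ^ m * pi ^ (2 * p + 2 * m + 1)) *
          (- 2 * (-1) ^ p * (-1) ^ k * stieltjes (2 * d + 1) (freq k) / freq k ^ (2 * p - 1)) =
          2 * (-1) ^ m * pi ^ (2 * p + 2 * m + 1) *
           ((-1) ^ k * stieltjes (2 * (p - m) - 1) (freq k) / freq k ^ (2 * p - 1))"
      unfolding sq by simp
  qed
  finally have L: "L = complex_of_real (- ((-1) ^ p * (-1) ^ m * pi ^ (2 * p + 2 * m + 1)) * W)"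
    using line_integral(2) sums_unique2 unfolding L_def F_def by blast
  have "\<i> * (-1) ^ p / of_real pi ^ (2 * p + 1) * vertical_line_integral c F =
          - (complex_of_real ((-1) ^ p / pi ^ (2 * p + 1)) * L)"
  proof -
    have "\<i> * x / y * (\<i> * L) = (\<i> * \<i>) * (x / y * L)" for x y
      by (simp only: mult_ac times_divide_eq_left times_divide_eq_right)
    thus ?thesis
      unfolding vertical_line_integral_def L_def[symmetric] by simp
  qed
  also have "\<dots> = complex_of_real (((-1) ^ p * (-1) ^ p) * ((-1) ^ m * (pi ^ (2 * p + 2 * m + 1) / pi ^ (2 * p + 1))) * W)"
    unfolding L by simp
  also have "pi ^ (2 * p + 2 * m + 1) / pi ^ (2 * p + 1) = pi ^ (2 * m)"
    by (simp add: power_add)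
  also have "((-1) ^ p * (-1) ^ p) * ((-1) ^ m * pi ^ (2 * m)) * W = (-1) ^ m * pi ^ (2 * m) * W"
    unfolding sq by simp
  also have "\<dots> = ((-1) ^ m * (-1) ^ m) * (pi ^ (2 * m + 1) * inverse_freq_sum (2 * m + 1)) + (-1) ^ m * pi ^ (2 * m) *
             ((\<Sum>j\<le>m. sech_coeff j * harm (2 * m - 2 * j) / fact (2 * m - 2 * j))
            + (\<Sum>j<d. fact (2 * j + 1) * sech_coeff (m + Suc j)))"
    by (simp add: W_def ring_distribs)
  also have "(-1) ^ m * (-1) ^ m = (1 :: real)" by (simp flip: power_add)
  finally show ?thesis by (simp only: d_def mult_1_left)
qed

end

theorem mainTheorem7:
  fixes m p :: nat and c :: real
  assumes "m \<ge> 1" and "p > m"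
    and "real m < c" and "c < real m + 1"
  shows "(\<forall>t. Re t = c \<longrightarrow> summable (\<lambda>k::nat.
           (-1) ^ k * (of_nat k + 1/2 :: complex) powr (2 * t - 2 * of_nat p - 2 * of_nat m - 1)))
       \<and> vertical_line_integrable c (\<lambda>t.
           Gamma (2 * of_nat p - 2 * t) * of_real pi powr (2 * t) / sin (of_real pi * t) *
           (\<Sum>k. (-1) ^ k * (of_nat k + 1/2) powr (2 * t - 2 * of_nat p - 2 * of_nat m - 1)))
       \<and> (2 ^ (2 * m + 1) - 1) * riemann_zeta (of_nat (2 * m + 1)) =
           \<i> * (-1) ^ p / of_real pi ^ (2 * p + 1) *
           vertical_line_integral c (\<lambda>t.
             Gamma (2 * of_nat p - 2 * t) * of_real pi powr (2 * t) / sin (of_real pi * t) *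
             (\<Sum>k. (-1) ^ k * (of_nat k + 1/2) powr (2 * t - 2 * of_nat p - 2 * of_nat m - 1)))
         - complex_of_real ((-1) ^ m * pi ^ (2 * m) *
             ((\<Sum>j<p - 1 - m. Gamma (2 * real j + 2) * euler_number (2 * j + 2 + 2 * m) /
                               Gamma (2 * real j + 3 + 2 * real m))
              + (\<Sum>j\<le>m. euler_number (2 * j) * Digamma (1 - 2 * real j + 2 * real m) /
                         (Gamma (1 - 2 * real j + 2 * real m) * Gamma (2 * real j + 1)))))"
proof (intro conjI allI impI)
  note hyps = assms(2,3,4,1)
  show "summable (\<lambda>k::nat. (-1) ^ k * (of_nat k + 1/2 :: complex) powr (2 * t - 2 * of_nat p - 2 * of_nat m - 1))"
    if "Re t = c" for t
    by (rule summable_line[OF hyps that])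
  show "vertical_line_integrable c (\<lambda>t.
           Gamma (2 * of_nat p - 2 * t) * of_real pi powr (2 * t) / sin (of_real pi * t) *
           (\<Sum>k. (-1) ^ k * (of_nat k + 1/2) powr (2 * t - 2 * of_nat p - 2 * of_nat m - 1)))"
    unfolding vertical_line_integrable_def by (rule line_integral(1)[OF hyps])
  have zeta: "(2 ^ (2 * m + 1) - 1) * riemann_zeta (of_nat (2 * m + 1)) =
                complex_of_real (pi ^ (2 * m + 1) * inverse_freq_sum (2 * m + 1))"
    using assms(1) by (intro inverse_freq_sum_zeta[symmetric]) simp
  show "(2 ^ (2 * m + 1) - 1) * riemann_zeta (of_nat (2 * m + 1)) =
           \<i> * (-1) ^ p / of_real pi ^ (2 * p + 1) *
           vertical_line_integral c (\<lambda>t.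
             Gamma (2 * of_nat p - 2 * t) * of_real pi powr (2 * t) / sin (of_real pi * t) *
             (\<Sum>k. (-1) ^ k * (of_nat k + 1/2) powr (2 * t - 2 * of_nat p - 2 * of_nat m - 1)))
         - complex_of_real ((-1) ^ m * pi ^ (2 * m) *
             ((\<Sum>j<p - 1 - m. Gamma (2 * real j + 2) * euler_number (2 * j + 2 + 2 * m) /
                               Gamma (2 * real j + 3 + 2 * real m))
              + (\<Sum>j\<le>m. euler_number (2 * j) * Digamma (1 - 2 * real j + 2 * real m) /
                         (Gamma (1 - 2 * real j + 2 * real m) * Gamma (2 * real j + 1)))))"
    unfolding line_integral_value[OF hyps] zeta digamma_sum[OF assms(1)] gamma_sum of_real_diff[symmetric]
    by (rule arg_cong[of _ _ complex_of_real]) (simp add: add.commute)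
qed

end
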